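(* Let $n$ be a positive integer and let $Z$ be an isotropic measure on the unit sphere $S^{n-1}\subset\mathbb{R}^n$ whose centroid is at the origin. Then $$|Z_\infty| \ge \frac{(n+1)^{(n+1)/2}\,n^{-n/2}}{n!},$$ with equality if and only if $Z_\infty$ is a regular simplex inscribed in $S^{n-1}$.
   Context: Throughout, $x\cdot y$ is the standard inner product on $\mathbb{R}^n$, $|x|$ is the Euclidean norm of a vector $x$, $S^{n-1}$ is the unit sphere of $\mathbb{R}^n$, and for a convex body $K\subset\mathbb{R}^n$, $|K|$ denotes its $n$-dimensional volume (Lebesgue measure). A finite nonnegative Borel measure $Z$ on $S^{n-1}$ is called isotropic if $|x|^2=\int_{S^{n-1}}|x\cdot u|^2\,dZ(u)$ for all $x\in\mathbb{R}^n$. The centroid of $Z$ is $\frac{1}{Z(S^{n-1})}\int_{S^{n-1}}u\,dZ(u)$. Define $Z_\infty=\operatorname{conv}(\operatorname{supp}Z)$, the convex hull of the support of $Z$. A simplex is inscribed in $S^{n-1}$ if all its vertices lie on $S^{n-1}$. *)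

theory Defs
  imports "HOL-Analysis.Analysis"
begin

definition finite_sphere_measure :: "(real ^ 'n) measure \<Rightarrow> bool" where
  "finite_sphere_measure Z \<longleftrightarrow>
     finite_measure Z \<and> sets Z = sets (restrict_space borel (sphere 0 1))"

definition isotropic :: "(real ^ 'n) measure \<Rightarrow> bool" where
  "isotropic Z \<longleftrightarrow> (\<forall>x. (norm x)\<^sup>2 = (LINT u|Z. \<bar>x \<bullet> u\<bar>\<^sup>2))"

definition centroid :: "(real ^ 'n) measure \<Rightarrow> real ^ 'n" where
  "centroid Z = (1 / measure Z (space Z)) *\<^sub>R (LINT u|Z. u)"

definition supp :: "'a::topological_space measure \<Rightarrow> 'a set" where
  "supp Z = {u \<in> space Z.
     \<forall>U. openin (top_of_set (space Z)) U \<and> u \<in> U \<longrightarrow> 0 < emeasure Z U}"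

definition Z_infty :: "(real ^ 'n) measure \<Rightarrow> (real ^ 'n) set" where
  "Z_infty Z = convex hull (supp Z)"

definition vertices :: "(real ^ 'n) set \<Rightarrow> (real ^ 'n) set" where
  "vertices P = {v. v extreme_point_of P}"

text \<open>A simplex is regular when all its edges have the same length; any two of its vertices
  span an edge. Only full-dimensional simplices are considered.\<close>

definition regular_simplex :: "(real ^ 'n) set \<Rightarrow> bool" where
  "regular_simplex P \<longleftrightarrow> int CARD('n) simplex P \<and>
     (\<exists>l. \<forall>v\<in>vertices P. \<forall>w\<in>vertices P. v \<noteq> w \<longrightarrow> dist v w = l)"

definition inscribed_in_sphere :: "(real ^ 'n) set \<Rightarrow> bool" where
  "inscribed_in_sphere P \<longleftrightarrow> vertices P \<subseteq> sphere 0 1"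

end

theory Submission
  imports Defs "HOL-Probability.Probability"
begin

text \<open>The proof is a transport argument in the style of Barthe's reverse Brascamp--Lieb inequality, carried
  out one dimension higher. With \<open>n = CARD('n)\<close>, send a point \<open>u\<close> of the sphere to the unit vector
  \<open>lift u = (1 / sqrt (n + 1), sqrt (n / (n + 1)) u)\<close> of \<open>\<real> \<times> \<real>\<^sup>n\<close>. Because \<open>Z\<close> is isotropic and has its
  centroid at the origin, the measure \<open>(n + 1) / n \<cdot> Z\<close> makes these vectors an isotropic frame: the
  weighted sum of the projections \<open>lift u \<otimes> lift u\<close> is the identity. All lifted vectors lie in the
  hyperplane \<open>height_form \<bullet> x = 1\<close>, and the cone over the body \<open>Z_infty Z\<close> is where the volume enters:
  integrating over slices, the integral of \<open>exp (- (height_form \<bullet> x))\<close> over the cone is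
  the volume of the body divided by that of the regular simplex (\<open>has_integral_cone\<close>). So the claim is
  that this integral is at least 1.

  Let \<open>T = gauss_exp_map\<close> be the increasing map carrying the standard normal law to the exponential law,
  so that \<open>T' exp (- T)\<close> is the Gaussian density. The map \<open>y \<mapsto> \<integral> T (y \<bullet> lift u) lift u\<close> is injective and
  takes values in the cone (\<open>transport_in_cone\<close>), since it is a positive combination of lifted points of
  the support. Its derivative is the frame operator with weights \<open>t u = T' (y \<bullet> lift u)\<close>, and the
  inequality of Ball and Barthe, \<open>ln det \<ge> \<integral> ln t\<close>, shows that the integrand on the cone, pulled back by
  the map, dominates the standard Gaussian density of \<open>\<real>\<^sup>n\<^sup>+\<^sup>1\<close>, whose integral is 1. The determinant
  inequality is proved in an orthonormal eigenbasis \<open>e\<^sub>i\<close> of the frame operator: isotropy says that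
  \<open>(v \<bullet> e\<^sub>i)\<^sup>2\<close> is a probability density for every \<open>i\<close>, the eigenvalue is the mean of \<open>t\<close> under it,
  and Jensen's inequality applies (\<open>frame_det_bound\<close>).

  Equality in Jensen's inequality says exactly that almost every frame vector is an eigenvector of the
  frame operator, with eigenvalue its own weight. Eigenvectors with different eigenvalues are orthogonal,
  and as \<open>T'\<close> is not constant, any two distinct points of the support receive different weights for
  some \<open>y\<close>. Hence equality of volumes forces the lifted support to be an orthonormal basis, which means
  that the support itself consists of the vertices of a regular simplex. Conversely, when \<open>Z_infty Z\<close> is
  an inscribed simplex, the support is its vertex set, isotropy makes the lifted vertices orthonormal,
  the eigenvector condition holds everywhere, and the transport map fills the cone up to finitely many
  hyperplanes; all inequalities become equalities.\<close>

section \<open>Self-adjoint operators and orthonormal eigenbases\<close>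

text \<open>The Rayleigh quotient attains its maximum on the compact unit sphere of the subspace. At a
  maximiser \<open>e\<close> the first variation in the direction of \<open>f e - c e\<close>, which is orthogonal to \<open>e\<close>, must vanish, and
  this forces that vector to be zero.\<close>

lemma self_adjoint_eigenvector:
  fixes f :: "'a::euclidean_space \<Rightarrow> 'a"
  assumes lin: "linear f" and sa: "\<And>x y. f x \<bullet> y = x \<bullet> f y"
    and S: "subspace S" "f ` S \<subseteq> S" "S \<noteq> {0}"
  obtains e c where "e \<in> S" "norm e = 1" "f e = c *\<^sub>R e"
proof -
  have "compact (S \<inter> sphere 0 1)"
    using S(1) by (intro closed_Int_compact closed_subspace) auto
  moreover obtain x where x: "x \<in> S" "x \<noteq> 0"
    using S(1,3) subspace_0 by blast
  have "(1 / norm x) *\<^sub>R x \<in> S \<inter> sphere 0 1"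
    using x S(1) by (auto simp: subspace_scale)
  then have "S \<inter> sphere 0 1 \<noteq> {}" by blast
  moreover have "continuous_on (S \<inter> sphere 0 1) (\<lambda>x. x \<bullet> f x)"
    by (intro continuous_intros linear_continuous_on linear_conv_bounded_linear[THEN iffD1] lin)
  ultimately obtain e where e: "e \<in> S \<inter> sphere 0 1"
    and emax: "\<And>y. y \<in> S \<inter> sphere 0 1 \<Longrightarrow> y \<bullet> f y \<le> e \<bullet> f e"
    using continuous_attains_sup[of "S \<inter> sphere 0 1" "\<lambda>x. x \<bullet> f x"] by blast
  define c where "c = e \<bullet> f e"
  have bound: "y \<bullet> f y \<le> c * (y \<bullet> y)" if "y \<in> S" for y
  proof (cases "y = 0")
    case True then show ?thesis by simp
  next
    case False
    have "(1 / norm y) *\<^sub>R y \<in> S \<inter> sphere 0 1"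
      using that False S(1) by (auto simp: subspace_scale)
    from emax[OF this] have "(y \<bullet> f y) / (norm y)\<^sup>2 \<le> c"
      by (simp add: c_def linear_cmul[OF lin] power2_eq_square)
    then show ?thesis
      using False by (simp add: divide_le_eq dot_square_norm)
  qed
  define g where "g = f e - c *\<^sub>R e"
  have gS: "g \<in> S"
    unfolding g_def using e S by (intro subspace_diff subspace_scale) auto
  have ee: "e \<bullet> e = 1" using e by (simp add: dot_square_norm)
  \<comment> \<open>the coefficient of the second-order term in the variation \<open>e + t g\<close>\<close>
  define b where "b = c * (g \<bullet> g) - g \<bullet> f g"
  have fe: "f e = g + c *\<^sub>R e" by (simp add: g_def)
  have ge: "g \<bullet> e = 0"
    using ee by (simp add: g_def c_def inner_diff_right inner_diff_left inner_commute[of "f e" e])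
  have key: "2 * t * (g \<bullet> g) \<le> t\<^sup>2 * b" for t :: real
  proof -
    have "(e + t *\<^sub>R g) \<bullet> f (e + t *\<^sub>R g) \<le> c * ((e + t *\<^sub>R g) \<bullet> (e + t *\<^sub>R g))"
      using e gS S(1) by (intro bound subspace_add subspace_scale) auto
    moreover have "e \<bullet> f g = g \<bullet> g"
      using sa[of e g] by (simp add: fe inner_add_left ge inner_commute[of e g])
    ultimately show ?thesis
      using ee ge
      by (simp add: linear_add[OF lin] linear_cmul[OF lin] inner_add_left inner_add_right fe
          inner_commute[of e g] b_def algebra_simps power2_eq_square)
  qed
  have "g \<bullet> g = 0"
  proof (rule ccontr)
    assume "g \<bullet> g \<noteq> 0"
    then have pos: "g \<bullet> g > 0" by simp
    show False
    proof (cases "b \<le> 0")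
      case True
      then show False using key[of 1] pos by simp
    next
      case False
      have "2 * ((g \<bullet> g) / b) * (g \<bullet> g) \<le> ((g \<bullet> g) / b)\<^sup>2 * b" by (rule key)
      also have "\<dots> = ((g \<bullet> g) / b) * (g \<bullet> g)"
        using False by (simp add: power2_eq_square)
      finally have "((g \<bullet> g) / b) * (g \<bullet> g) \<le> 0" by simp
      moreover have "((g \<bullet> g) / b) * (g \<bullet> g) > 0" using False pos by simp
      ultimately show False by linarith
    qed
  qed
  then have "f e = c *\<^sub>R e" by (simp add: fe)
  then show ?thesis using e by (intro that[of e c]) auto
qed

text \<open>Split off one eigenvector at a time: its orthogonal complement is again invariant because \<open>f\<close> is
  self-adjoint, and has smaller dimension.\<close>

lemma self_adjoint_orthonormal_eigenbasis:
  fixes f :: "'a::euclidean_space \<Rightarrow> 'a"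
  assumes lin: "linear f" and sa: "\<And>x y. f x \<bullet> y = x \<bullet> f y"
    and "subspace S" "f ` S \<subseteq> S"
  shows "\<exists>B. pairwise orthogonal B \<and> (\<forall>b\<in>B. norm b = 1 \<and> (\<exists>c. f b = c *\<^sub>R b)) \<and> span B = S"
  using assms(3,4)
proof (induction "dim S" arbitrary: S rule: less_induct)
  case less
  show ?case
  proof (cases "S = {0}")
    case True
    then show ?thesis by (intro exI[of _ "{}"]) auto
  next
    case False
    obtain e c where e: "e \<in> S" "norm e = 1" "f e = c *\<^sub>R e"
      using self_adjoint_eigenvector[OF lin sa less.prems False] by blast
    define S' where "S' = S \<inter> {x. e \<bullet> x = 0}"
    have sub: "subspace S'"
      unfolding S'_def using subspace_hyperplane less.prems(1) by (rule subspace_inter[rotated])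
    have inv: "f ` S' \<subseteq> S'"
    proof -
      have "e \<bullet> f x = 0" if "e \<bullet> x = 0" for x
        using that sa[of e x] e(3) by simp
      then show ?thesis using less.prems(2) by (auto simp: S'_def)
    qed
    have "e \<notin> S'" using e by (auto simp: S'_def)
    moreover have "S' \<subseteq> S" by (auto simp: S'_def)
    ultimately have "S' \<subset> S" using e(1) by blast
    then have "dim S' < dim S"
      using sub less.prems(1) by (intro dim_psubset) (simp add: span_eq_iff[THEN iffD2])
    from less.hyps[OF this sub inv] obtain B where
      B: "pairwise orthogonal B" "\<And>b. b \<in> B \<Longrightarrow> norm b = 1 \<and> (\<exists>c. f b = c *\<^sub>R b)" "span B = S'"
      by blast
    have orth: "e \<bullet> b = 0" if "b \<in> B" for b
      using span_base[OF that] B(3) by (auto simp: S'_def)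
    have "span (insert e B) = S"
    proof
      show "span (insert e B) \<subseteq> S"
        using e(1) B(3) span_superset[of B] less.prems(1) by (intro span_minimal) (auto simp: S'_def)
      show "S \<subseteq> span (insert e B)"
      proof
        fix x assume x: "x \<in> S"
        have "x - (e \<bullet> x) *\<^sub>R e \<in> S'"
          using x e less.prems(1)
          by (auto simp: S'_def inner_diff_right dot_square_norm intro!: subspace_diff subspace_scale)
        then show "x \<in> span (insert e B)"
          using B(3) by (auto simp: span_insert)
      qed
    qed
    moreover have "pairwise orthogonal (insert e B)"
      using B(1) orth by (auto simp: pairwise_insert orthogonal_def inner_commute)
    ultimately show ?thesis
      using e B(2) by (intro exI[of _ "insert e B"]) auto
  qed
qed

lemma orthonormal_basis_facts:
  fixes B :: "'a::euclidean_space set"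
  assumes "pairwise orthogonal B" "\<And>b. b \<in> B \<Longrightarrow> norm b = 1" "span B = UNIV"
  shows orthonormal_basis_finite: "finite B"
    and orthonormal_basis_card: "card B = DIM('a)"
    and orthonormal_basis_expansion: "(\<Sum>b\<in>B. (x \<bullet> b) *\<^sub>R b) = x"
    and orthonormal_basis_parseval: "(\<Sum>b\<in>B. (x \<bullet> b)\<^sup>2) = (norm x)\<^sup>2"
proof -
  have "0 \<notin> B" using assms(2) by force
  then have ind: "independent B" using assms(1) pairwise_orthogonal_independent by blast
  then show fin: "finite B" by (simp add: independent_bound_general)
  show "card B = DIM('a)"
    using ind assms(3) by (metis dim_UNIV dim_eq_card dim_span)
  have bb: "b \<bullet> b' = (if b = b' then 1 else 0)" if "b \<in> B" "b' \<in> B" for b b'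
    using that pairwiseD[OF assms(1), of b b'] assms(2)[of b] by (auto simp: orthogonal_def dot_square_norm)
  show exp: "(\<Sum>b\<in>B. (x \<bullet> b) *\<^sub>R b) = x"
  proof -
    define r where "r = x - (\<Sum>b\<in>B. (x \<bullet> b) *\<^sub>R b)"
    have "r \<bullet> b' = 0" if "b' \<in> B" for b'
    proof -
      have "(\<Sum>b\<in>B. (x \<bullet> b) * (b \<bullet> b')) = (\<Sum>b\<in>B. if b = b' then x \<bullet> b else 0)"
        by (intro sum.cong) (use that in \<open>auto simp: bb\<close>)
      then show ?thesis
        using that fin by (simp add: r_def inner_diff_left inner_sum_left)
    qed
    then have "orthogonal r r"
      using assms(3) by - (rule orthogonal_to_span[where S = B], auto simp: orthogonal_def)
    then show ?thesis by (simp add: r_def orthogonal_def)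
  qed
  have "(norm x)\<^sup>2 = x \<bullet> (\<Sum>b\<in>B. (x \<bullet> b) *\<^sub>R b)"
    by (simp add: exp dot_square_norm)
  then show "(\<Sum>b\<in>B. (x \<bullet> b)\<^sup>2) = (norm x)\<^sup>2"
    by (simp add: inner_sum_right power2_eq_square)
qed

text \<open>The matrix with the eigenvectors as columns conjugates \<open>f\<close> to a diagonal matrix.\<close>

lemma det_orthonormal_eigenbasis:
  fixes f :: "real^'m \<Rightarrow> real^'m"
  assumes lin: "linear f"
    and B: "pairwise orthogonal B" "\<And>b. b \<in> B \<Longrightarrow> norm b = 1" "span B = UNIV"
    and eig: "\<And>b. b \<in> B \<Longrightarrow> f b = c b *\<^sub>R b"
  shows "det (matrix f) = (\<Prod>b\<in>B. c b)"
proof -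
  have "card B = CARD('m)" "finite B"
    using orthonormal_basis_card[OF B] orthonormal_basis_finite[OF B] by auto
  then obtain \<beta> where \<beta>: "bij_betw \<beta> (UNIV :: 'm set) B"
    using finite_same_card_bij[of "UNIV :: 'm set" B] by auto
  then have \<beta>B: "\<beta> i \<in> B" for i by (auto simp: bij_betw_def)
  have \<beta>\<beta>: "\<beta> i \<bullet> \<beta> j = (if i = j then 1 else 0)" for i j
    using pairwiseD[OF B(1) \<beta>B \<beta>B, of i j] B(2)[OF \<beta>B, of i] \<beta>
    by (auto simp: orthogonal_def dot_square_norm bij_betw_def inj_def)
  define P :: "real^'m^'m" where "P = (\<chi> i j. \<beta> j $ i)"
  define D :: "real^'m^'m" where "D = (\<chi> i j. if i = j then c (\<beta> i) else 0)"
  have "transpose P ** P = mat 1"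
    using \<beta>\<beta> by (simp add: matrix_matrix_mult_def transpose_def P_def mat_def vec_eq_iff inner_vec_def)
  then have "det P \<noteq> 0"
    by (metis det_I det_mul mult_zero_right zero_neq_one)
  have col: "P *v axis j 1 = \<beta> j" for j
    by (simp add: matrix_vector_mult_basis column_def P_def)
  have colD: "D *v axis j 1 = c (\<beta> j) *\<^sub>R axis j 1" for j
    by (simp only: matrix_vector_mult_basis) (auto simp: column_def D_def vec_eq_iff axis_def)
  have "matrix f ** P = P ** D"
  proof -
    have "(matrix f ** P) *v axis j 1 = (P ** D) *v axis j 1" for j
    proof -
      have "(matrix f ** P) *v axis j 1 = f (\<beta> j)"
        by (simp add: matrix_vector_mul_assoc[symmetric] col matrix_works lin)
      also have "\<dots> = P *v (D *v axis j 1)"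
        by (simp only: colD matrix_vector_mult_scaleR col eig[OF \<beta>B])
      finally show ?thesis by (simp add: matrix_vector_mul_assoc)
    qed
    then have "column j (matrix f ** P) = column j (P ** D)" for j
      by (simp add: matrix_vector_mult_basis)
    then show ?thesis by (simp add: column_def vec_eq_iff)
  qed
  then have "det (matrix f) * det P = det P * det D"
    by (metis det_mul)
  then have "det (matrix f) = det D" using \<open>det P \<noteq> 0\<close> by simp
  also have "\<dots> = (\<Prod>i\<in>UNIV. c (\<beta> i))"
    by (subst det_diagonal) (auto simp: D_def)
  also have "\<dots> = (\<Prod>b\<in>B. c b)"
    using \<beta> by (rule prod.reindex_bij_betw)
  finally show ?thesis .
qed

section \<open>Transport of the Gaussian to the exponential distribution\<close>

abbreviation std_normal :: "real measure" where
  "std_normal \<equiv> density lborel std_normal_density"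

text \<open>The monotone rearrangement of the standard normal law to the exponential law on the positive half
  line: \<open>s = gauss_exp_map t\<close> solves \<open>1 - exp (- s) = \<Phi> t\<close>, which equates the two distribution functions.\<close>

definition gauss_exp_map :: "real \<Rightarrow> real" where
  "gauss_exp_map t = - ln (1 - cdf std_normal t)"

text \<open>Differentiating \<open>exp (- T) = 1 - \<Phi>\<close> gives this formula for the derivative of the rearrangement; in
  this form its logarithm separates into a Gaussian part and \<open>T\<close> itself.\<close>

definition gauss_exp_deriv :: "real \<Rightarrow> real" where
  "gauss_exp_deriv t = std_normal_density t * exp (gauss_exp_map t)"

lemma real_distribution_std_normal: "real_distribution std_normal"
  by (rule real_dist_normal_dist)

lemma cdf_std_normal_deriv: "(cdf std_normal has_real_derivative std_normal_density t) (at t)"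
proof -
  interpret real_distribution std_normal by (rule real_distribution_std_normal)
  have eq: "cdf std_normal x = cdf std_normal (t - 1) + integral {t - 1..x} std_normal_density"
    if "x \<in> {t - 1..t + 1}" for x
  proof -
    have "cdf std_normal x - cdf std_normal (t - 1) = measure std_normal {t - 1<..x}"
    proof (cases "t - 1 < x")
      case True then show ?thesis by (simp add: cdf_diff_eq)
    next
      case False
      then have "x = t - 1" using that by auto
      then show ?thesis by simp
    qed
    also have "\<dots> = (LINT y|std_normal. indicator {t - 1<..x} y)"
      by simp
    also have "\<dots> = (LINT y|lborel. std_normal_density y * indicator {t - 1<..x} y)"
      by (subst integral_density) auto
    also have "\<dots> = (LINT y:{t-1..x}|lborel. std_normal_density y)"
      unfolding set_lebesgue_integral_def
      by (intro integral_cong_AE) (use AE_lborel_singleton[of "t - 1"] in \<open>auto elim!: eventually_mono simp: indicator_def\<close>)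
    also have "\<dots> = integral {t-1..x} std_normal_density"
      using integrable_mult_indicator[of "{t-1..x}" lborel std_normal_density]
      by (intro set_borel_integral_eq_integral) (simp add: set_integrable_def)
    finally show ?thesis by simp
  qed
  have "((\<lambda>x. integral {t - 1..x} std_normal_density) has_real_derivative std_normal_density t) (at t within {t-1..t+1})"
    by (rule integral_has_real_derivative) (auto simp: normal_density_def intro!: continuous_intros)
  then have "((\<lambda>x. cdf std_normal (t - 1) + integral {t - 1..x} std_normal_density) has_real_derivative std_normal_density t) (at t within {t-1..t+1})"
    by (auto intro!: derivative_eq_intros)
  then have "(cdf std_normal has_real_derivative std_normal_density t) (at t within {t-1..t+1})"
    by (rule has_field_derivative_transform_within[OF _ zero_less_one])
      (simp_all add: eq[symmetric])
  moreover have "at t within {t-1..t+1} = at t"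
    by (rule at_within_interior) auto
  ultimately show ?thesis by simp
qed

lemma cdf_std_normal_strict_mono: "x < y \<Longrightarrow> cdf std_normal x < cdf std_normal y"
  by (rule DERIV_pos_imp_increasing[of x y]) (use cdf_std_normal_deriv normal_density_pos[of 1] in \<open>blast intro: zero_less_one\<close>)+

lemma cdf_std_normal_bounds: "0 < cdf std_normal t" "cdf std_normal t < 1"
proof -
  interpret real_distribution std_normal by (rule real_distribution_std_normal)
  show "0 < cdf std_normal t"
    using cdf_std_normal_strict_mono[of "t - 1" t] cdf_nonneg[of "t - 1"] by simp
  show "cdf std_normal t < 1"
    using cdf_std_normal_strict_mono[of t "t + 1"] cdf_bounded_prob[of "t + 1"] by simp
qed

lemma gauss_exp_map_pos: "0 < gauss_exp_map t"
  using cdf_std_normal_bounds[of t] by (simp add: gauss_exp_map_def)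

lemma gauss_exp_map_deriv: "(gauss_exp_map has_real_derivative gauss_exp_deriv t) (at t)"
proof -
  have pos: "0 < 1 - cdf std_normal t" using cdf_std_normal_bounds[of t] by simp
  have "((\<lambda>t. - ln (1 - cdf std_normal t)) has_real_derivative
      - (inverse (1 - cdf std_normal t) * (0 - std_normal_density t))) (at t)"
    by (intro DERIV_minus DERIV_chain2[where f = ln and g = "\<lambda>t. 1 - cdf std_normal t" and x = t, OF DERIV_ln[OF pos]] DERIV_diff DERIV_const
        cdf_std_normal_deriv)
  moreover have "- (inverse (1 - cdf std_normal t) * (0 - std_normal_density t)) = gauss_exp_deriv t"
    using pos by (simp add: gauss_exp_deriv_def gauss_exp_map_def exp_minus)
  ultimately have "((\<lambda>t. - ln (1 - cdf std_normal t)) has_real_derivative gauss_exp_deriv t) (at t)"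
    by simp
  then show ?thesis by (simp add: gauss_exp_map_def[abs_def])
qed

lemma gauss_exp_deriv_pos: "0 < gauss_exp_deriv t"
  by (simp add: gauss_exp_deriv_def normal_density_pos)

lemma continuous_on_gauss_exp_map: "continuous_on S gauss_exp_map"
  using gauss_exp_map_deriv by (meson DERIV_isCont continuous_at_imp_continuous_on)

lemma continuous_on_gauss_exp_deriv: "continuous_on S gauss_exp_deriv"
  unfolding gauss_exp_deriv_def[abs_def] normal_density_def
  by (intro continuous_intros continuous_on_gauss_exp_map) auto

lemma gauss_exp_map_strict_mono: "x < y \<Longrightarrow> gauss_exp_map x < gauss_exp_map y"
  by (rule DERIV_pos_imp_increasing[of x y]) (use gauss_exp_map_deriv gauss_exp_deriv_pos in \<open>blast\<close>)+

lemma ln_gauss_exp_deriv: "ln (gauss_exp_deriv t) = ln (std_normal_density t) + gauss_exp_map t"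
  using normal_density_pos[of 1 0 t] by (simp add: gauss_exp_deriv_def ln_mult)

lemma gauss_exp_map_surj:
  assumes "0 < r" obtains t where "gauss_exp_map t = r"
proof -
  interpret real_distribution std_normal by (rule real_distribution_std_normal)
  \<comment> \<open>the level of the distribution function that corresponds to the value \<open>r\<close>\<close>
  define p where "p = 1 - exp (- r)"
  have p: "0 < p" "p < 1" using assms by (auto simp: p_def)
  have "eventually (\<lambda>x. cdf std_normal x < p) at_bot"
    using cdf_lim_at_bot p by (simp add: order_tendstoD)
  then obtain a where a: "cdf std_normal a < p"
    by (metis eventually_at_bot_linorder order_refl)
  have "eventually (\<lambda>x. p < cdf std_normal x) at_top"
    using cdf_lim_at_top_prob p by (simp add: order_tendstoD)
  then obtain b where b: "p < cdf std_normal b"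
    by (metis eventually_at_top_linorder order_refl)
  have "a \<le> b"
    using a b cdf_std_normal_strict_mono[of b a] by linarith
  moreover have "continuous_on {a..b} (cdf std_normal)"
    using cdf_std_normal_deriv by (meson DERIV_isCont continuous_at_imp_continuous_on)
  ultimately obtain t where "cdf std_normal t = p"
    using IVT'[of "cdf std_normal" a p b] a b by auto
  then have "gauss_exp_map t = r" by (simp add: gauss_exp_map_def p_def)
  then show ?thesis by (rule that)
qed

text \<open>Otherwise the rearrangement would be an affine function of positive slope, which cannot be positive
  on the whole line.\<close>

lemma gauss_exp_deriv_nonconstant: obtains a b where "gauss_exp_deriv a \<noteq> gauss_exp_deriv b"
proof -
  have False if const: "\<And>a. gauss_exp_deriv a = gauss_exp_deriv 0"
  proof -
    define d where "d = gauss_exp_deriv 0"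
    have "d > 0" unfolding d_def by (rule gauss_exp_deriv_pos)
    have "\<exists>k. \<forall>t. gauss_exp_map t - d * t = k"
    proof -
      have "((\<lambda>t. gauss_exp_map t - d * t) has_real_derivative 0) (at t)" for t
        using const[of t] by (auto intro!: derivative_eq_intros gauss_exp_map_deriv simp: d_def)
      then show ?thesis by (metis DERIV_isconst_all)
    qed
    then obtain k where k: "\<And>t. gauss_exp_map t = k + d * t" by (metis diff_eq_eq)
    show False
      using gauss_exp_map_pos[of "- (k / d)"] \<open>d > 0\<close> by (simp add: k)
  qed
  then show ?thesis using that by blast
qed

text \<open>Uniformity of the linearisation over bounded arguments is what allows the transport map, an integral
  of values of \<open>gauss_exp_map\<close>, to be differentiated under the integral sign without dominated
  convergence. It follows from uniform continuity of the derivative on compact intervals.\<close>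

lemma gauss_exp_map_uniform_linearization:
  assumes "0 < e"
  obtains d where "0 < d"
    "\<And>p q. \<lbrakk>\<bar>p\<bar> \<le> R; \<bar>q - p\<bar> < d\<rbrakk> \<Longrightarrow>
      \<bar>gauss_exp_map q - gauss_exp_map p - gauss_exp_deriv p * (q - p)\<bar> \<le> e * \<bar>q - p\<bar>"
proof -
  have "uniformly_continuous_on {-(R+1)..R+1} gauss_exp_deriv"
    by (intro compact_uniformly_continuous continuous_on_gauss_exp_deriv) auto
  then obtain d where d: "0 < d" and
    close: "\<And>x x'. \<lbrakk>x \<in> {-(R+1)..R+1}; x' \<in> {-(R+1)..R+1}; dist x' x < d\<rbrakk> \<Longrightarrow>
      dist (gauss_exp_deriv x') (gauss_exp_deriv x) < e"
    using assms unfolding uniformly_continuous_on_def by meson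
  show ?thesis
  proof (rule that[of "min d 1"])
    show "0 < min d 1" using d by simp
    fix p q :: real assume pq: "\<bar>p\<bar> \<le> R" "\<bar>q - p\<bar> < min d 1"
    have "norm ((gauss_exp_map q - gauss_exp_deriv p * q) - (gauss_exp_map p - gauss_exp_deriv p * p))
        \<le> e * norm (q - p)"
    proof (rule field_differentiable_bound[where S = "closed_segment p q"
          and f' = "\<lambda>x. gauss_exp_deriv x - gauss_exp_deriv p"])
      fix x assume x: "x \<in> closed_segment p q"
      then have xp: "\<bar>x - p\<bar> \<le> \<bar>q - p\<bar>"
        by (auto simp: closed_segment_eq_real_ivl split: if_splits)
      show "((\<lambda>x. gauss_exp_map x - gauss_exp_deriv p * x) has_field_derivative
          gauss_exp_deriv x - gauss_exp_deriv p) (at x within closed_segment p q)"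
        by (rule DERIV_subset[OF _ subset_UNIV])
          (auto intro!: derivative_eq_intros gauss_exp_map_deriv)
      have "dist (gauss_exp_deriv x) (gauss_exp_deriv p) < e"
        by (rule close) (use pq xp in \<open>auto simp: dist_real_def\<close>)
      then show "norm (gauss_exp_deriv x - gauss_exp_deriv p) \<le> e"
        by (simp add: dist_norm)
    qed auto
    then show "\<bar>gauss_exp_map q - gauss_exp_map p - gauss_exp_deriv p * (q - p)\<bar> \<le> e * \<bar>q - p\<bar>"
      by (simp add: algebra_simps)
  qed
qed

definition std_normal_vec :: "'a::euclidean_space \<Rightarrow> real" where
  "std_normal_vec y = (\<Prod>b\<in>Basis. std_normal_density (y \<bullet> b))"

lemma std_normal_vec_pos: "0 < std_normal_vec y"
  unfolding std_normal_vec_def by (intro prod_pos) (auto intro: normal_density_pos)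

lemma has_integral_std_normal_vec: "((std_normal_vec :: 'a::euclidean_space \<Rightarrow> real) has_integral 1) UNIV"
proof -
  have 1: "(\<integral>\<^sup>+x. ennreal (std_normal_density x) \<partial>lborel) = 1"
    using prob_space.emeasure_space_1[OF prob_space_normal_density[of 1 0]]
    by (simp add: emeasure_density)
  have "(\<integral>\<^sup>+y. ennreal (\<Prod>b\<in>Basis. std_normal_density (y \<bullet> b)) \<partial>(lborel :: 'a measure))
      = (\<integral>\<^sup>+y. (\<Prod>b\<in>Basis. ennreal (std_normal_density (y \<bullet> b))) \<partial>(lborel :: 'a measure))"
    by (simp add: prod_ennreal)
  also have "\<dots> = (\<Prod>b\<in>(Basis :: 'a set). (\<integral>\<^sup>+x. ennreal (std_normal_density x) \<partial>lborel))"
    by (rule nn_integral_lborel_prod) auto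
  finally have "(\<integral>\<^sup>+y. ennreal (std_normal_vec y) \<partial>(lborel :: 'a measure)) = ennreal 1"
    using 1 by (simp add: std_normal_vec_def)
  moreover have "(std_normal_vec :: 'a \<Rightarrow> real) \<in> borel_measurable borel"
    unfolding std_normal_vec_def[abs_def] by measurable
  ultimately show ?thesis
    using std_normal_vec_pos by (intro nn_integral_has_integral) (auto intro: less_imp_le)
qed

section \<open>The determinant inequality of Ball and Barthe\<close>

text \<open>A resolution of the identity: \<open>\<integral> v \<otimes> v dM\<close> is the identity operator, expressed by its quadratic
  form. Indexing the unit vectors by an arbitrary measure space lets the same locale serve for the
  measure on the sphere itself and for its lift.\<close>

locale isotropic_frame = finite_measure M for M :: "'a measure" +
  fixes v :: "'a \<Rightarrow> real^'m"
  assumes v_measurable [measurable]: "v \<in> borel_measurable M"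
    and norm_v: "a \<in> space M \<Longrightarrow> norm (v a) = 1"
    and isotropic_v: "(LINT a|M. (x \<bullet> v a)\<^sup>2) = (norm x)\<^sup>2"
begin

lemma integrable_bounded:
  fixes f :: "'a \<Rightarrow> 'b::{banach, second_countable_topology}"
  assumes "f \<in> borel_measurable M" "\<And>a. a \<in> space M \<Longrightarrow> norm (f a) \<le> B"
  shows "integrable M f"
  using assms by (intro integrable_const_bound[where B = B]) auto

lemma inner_v_le: "a \<in> space M \<Longrightarrow> \<bar>x \<bullet> v a\<bar> \<le> norm x"
  using Cauchy_Schwarz_ineq2[of x "v a"] norm_v by simp

lemma integrable_inner_v_mult:
  assumes "t \<in> borel_measurable M" "\<And>a. a \<in> space M \<Longrightarrow> \<bar>t a\<bar> \<le> B"
  shows "integrable M (\<lambda>a. t a * ((x \<bullet> v a) * (y \<bullet> v a)))"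
proof (rule integrable_bounded)
  fix a assume a: "a \<in> space M"
  have "\<bar>t a\<bar> * (\<bar>x \<bullet> v a\<bar> * \<bar>y \<bullet> v a\<bar>) \<le> B * (norm x * norm y)"
    using assms(2)[OF a] inner_v_le[OF a] by (intro mult_mono) (auto intro: order_trans[OF abs_ge_zero])
  then show "norm (t a * ((x \<bullet> v a) * (y \<bullet> v a))) \<le> B * (norm x * norm y)"
    by (simp add: abs_mult)
qed (use assms(1) in measurable)

lemma integrable_inner_v_sq: "integrable M (\<lambda>a. (x \<bullet> v a)\<^sup>2)"
  using integrable_inner_v_mult[of "\<lambda>_. 1" 1 x x] by (simp add: power2_eq_square)

lemma inner_polarized: "(LINT a|M. (x \<bullet> v a) * (y \<bullet> v a)) = x \<bullet> y"
proof -
  have "(LINT a|M. (x \<bullet> v a) * (y \<bullet> v a))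
      = (LINT a|M. (1/4) * (((x + y) \<bullet> v a)\<^sup>2 - ((x - y) \<bullet> v a)\<^sup>2))"
    by (intro Bochner_Integration.integral_cong) (auto simp: inner_add_left inner_diff_left power2_eq_square algebra_simps)
  also have "\<dots> = (1/4) * ((norm (x + y))\<^sup>2 - (norm (x - y))\<^sup>2)"
    by (simp add: Bochner_Integration.integral_diff integrable_inner_v_sq isotropic_v)
  also have "\<dots> = x \<bullet> y"
    by (simp add: power2_norm_eq_inner inner_add_left inner_add_right inner_diff_left inner_diff_right inner_commute[of y x])
  finally show ?thesis .
qed

lemma integrable_scaleR_v:
  assumes "f \<in> borel_measurable M" "\<And>a. a \<in> space M \<Longrightarrow> \<bar>f a\<bar> \<le> B"
  shows "integrable M (\<lambda>a. f a *\<^sub>R v a)"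
  by (rule integrable_bounded[where B = B]) (use assms norm_v in auto)

lemma inner_integral_scaleR_v:
  assumes "f \<in> borel_measurable M" "\<And>a. a \<in> space M \<Longrightarrow> \<bar>f a\<bar> \<le> B"
  shows "x \<bullet> (LINT a|M. f a *\<^sub>R v a) = (LINT a|M. f a * (x \<bullet> v a))"
  using integral_inner_right[OF integrable_scaleR_v[OF assms], of x] by simp

text \<open>The polarised form of isotropy, read as an identity of vectors.\<close>

lemma reproducing: "(LINT a|M. (x \<bullet> v a) *\<^sub>R v a) = x"
proof -
  have "y \<bullet> (LINT a|M. (x \<bullet> v a) *\<^sub>R v a) = y \<bullet> x" for y
    using inner_integral_scaleR_v[of "\<lambda>a. x \<bullet> v a" "norm x" y] inner_v_le inner_polarized[of x y]
    by (simp add: inner_commute)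
  then show ?thesis by (metis vector_eq_ldot)
qed

lemma AE_inner_zero_imp:
  assumes "AE a in M. x \<bullet> v a = 0" shows "x = 0"
proof -
  have "(LINT a|M. (x \<bullet> v a)\<^sup>2) = 0"
    using assms by (intro integral_eq_zero_AE) (auto elim!: eventually_mono)
  then show ?thesis using isotropic_v[of x] by simp
qed

text \<open>This is the trace of the resolution of the identity.\<close>

lemma total_mass: "measure M (space M) = real CARD('m)"
proof -
  have "real CARD('m) = (\<Sum>b\<in>(Basis :: (real^'m) set). (norm b)\<^sup>2)"
    by simp
  also have "\<dots> = (LINT a|M. (\<Sum>b\<in>Basis. (b \<bullet> v a)\<^sup>2))"
    by (subst Bochner_Integration.integral_sum) (simp_all add: integrable_inner_v_sq isotropic_v)
  also have "\<dots> = (LINT a|M. 1)"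
  proof (intro Bochner_Integration.integral_cong refl)
    fix a assume "a \<in> space M"
    have "(\<Sum>b\<in>Basis. (b \<bullet> v a)\<^sup>2) = v a \<bullet> v a"
      by (simp add: euclidean_inner[of "v a" "v a"] power2_eq_square inner_commute)
    then show "(\<Sum>b\<in>Basis. (b \<bullet> v a)\<^sup>2) = 1"
      using norm_v[OF \<open>a \<in> space M\<close>] by (simp add: dot_square_norm)
  qed
  finally show ?thesis by simp
qed

definition frame_op :: "('a \<Rightarrow> real) \<Rightarrow> real^'m \<Rightarrow> real^'m" where
  "frame_op t x = (LINT a|M. (t a * (x \<bullet> v a)) *\<^sub>R v a)"

context
  fixes t :: "'a \<Rightarrow> real" and B :: real
  assumes t_meas [measurable]: "t \<in> borel_measurable M"
    and t_bound: "\<And>a. a \<in> space M \<Longrightarrow> \<bar>t a\<bar> \<le> B"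
begin

lemma frame_op_bound: "a \<in> space M \<Longrightarrow> \<bar>t a * (x \<bullet> v a)\<bar> \<le> B * norm x"
  using t_bound[of a] inner_v_le[of a x]
  by (auto simp: abs_mult intro!: mult_mono intro: order_trans[OF abs_ge_zero])

lemma inner_frame_op: "y \<bullet> frame_op t x = (LINT a|M. t a * ((x \<bullet> v a) * (y \<bullet> v a)))"
  unfolding frame_op_def
  by (subst inner_integral_scaleR_v[OF _ frame_op_bound[of _ x]]) (simp_all add: mult.assoc)

lemma linear_frame_op: "linear (frame_op t)"
proof (rule linearI)
  show "frame_op t (x + y) = frame_op t x + frame_op t y" for x y
  proof -
    have "frame_op t (x + y) = (LINT a|M. (t a * (x \<bullet> v a)) *\<^sub>R v a + (t a * (y \<bullet> v a)) *\<^sub>R v a)"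
      by (simp add: frame_op_def inner_add_left distrib_left scaleR_add_left)
    also have "\<dots> = frame_op t x + frame_op t y"
      unfolding frame_op_def
      by (intro Bochner_Integration.integral_add integrable_scaleR_v[OF _ frame_op_bound]) auto
    finally show ?thesis .
  qed
  show "frame_op t (c *\<^sub>R x) = c *\<^sub>R frame_op t x" for c x
  proof -
    have "frame_op t (c *\<^sub>R x) = (LINT a|M. c *\<^sub>R ((t a * (x \<bullet> v a)) *\<^sub>R v a))"
      by (simp add: frame_op_def mult_ac)
    also have "\<dots> = c *\<^sub>R frame_op t x"
      unfolding frame_op_def
      by (rule integral_scaleR_right)
    finally show ?thesis .
  qed
qed

lemma frame_op_self_adjoint: "frame_op t x \<bullet> y = x \<bullet> frame_op t y"
  by (simp add: inner_frame_op inner_commute[of "frame_op t x"] mult_ac)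

end

text \<open>Let \<open>\<mu> b\<close> be the eigenvalues of the frame operator in an orthonormal eigenbasis \<open>B\<close>. By isotropy each
  \<open>(b \<bullet> v)\<^sup>2\<close> has integral 1, and \<open>\<mu> b\<close> is the mean of \<open>t\<close> with this density. Integrating the elementary
  inequality \<open>ln x \<le> x - 1\<close> at \<open>x = t / \<mu> b\<close> is Jensen's inequality in the form
  \<open>ln (\<mu> b) \<ge> \<integral> (b \<bullet> v)\<^sup>2 ln t\<close>; summing over \<open>B\<close> gives the bound, since the squares add up to 1. The
  total deficit is the integral of a nonnegative function, so equality holds if and only if for almost
  every \<open>a\<close> and every \<open>b\<close> either \<open>b \<bullet> v a = 0\<close> or \<open>t a = \<mu> b\<close>, that is, if \<open>v a\<close> is an eigenvector for
  \<open>t a\<close>.\<close>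

lemma frame_det_bound:
  assumes t_meas [measurable]: "t \<in> borel_measurable M"
    and l: "0 < l" "\<And>a. a \<in> space M \<Longrightarrow> l \<le> t a" and u: "\<And>a. a \<in> space M \<Longrightarrow> t a \<le> u"
  shows frame_det_pos: "0 < det (matrix (frame_op t))"
    and frame_ln_det_ge: "(LINT a|M. ln (t a)) \<le> ln (det (matrix (frame_op t)))"
    and frame_ln_det_eq_iff: "(LINT a|M. ln (t a)) = ln (det (matrix (frame_op t)))
           \<longleftrightarrow> (AE a in M. frame_op t (v a) = t a *\<^sub>R v a)"
proof -
  have bd: "\<bar>t a\<bar> \<le> u" if "a \<in> space M" for a
    using l(1) l(2)[OF that] u[OF that] by simp
  have tpos: "0 < t a" if "a \<in> space M" for a using l(1) l(2)[OF that] by simp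
  note lin = linear_frame_op[OF t_meas bd] and sa = frame_op_self_adjoint[OF t_meas bd]
    and ifr = inner_frame_op[OF t_meas bd]
  obtain B where B: "pairwise orthogonal B" "span B = UNIV"
    "\<And>b. b \<in> B \<Longrightarrow> norm b = 1" "\<And>b. b \<in> B \<Longrightarrow> \<exists>c. frame_op t b = c *\<^sub>R b"
    using self_adjoint_orthonormal_eigenbasis[OF lin sa, of UNIV] by auto
  note onb = B(1,3,2)
  have fin: "finite B" by (rule orthonormal_basis_finite[OF onb])
  define \<mu> where "\<mu> b = b \<bullet> frame_op t b" for b
  have eig: "frame_op t b = \<mu> b *\<^sub>R b" if b: "b \<in> B" for b
  proof -
    obtain c where "frame_op t b = c *\<^sub>R b" using B(4)[OF b] by blast
    then show ?thesis using B(3)[OF b] by (simp add: \<mu>_def dot_square_norm)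
  qed
  have \<mu>_int: "\<mu> b = (LINT a|M. t a * (b \<bullet> v a)\<^sup>2)" for b
    by (simp add: \<mu>_def ifr power2_eq_square)
  have int_t: "integrable M (\<lambda>a. t a * (b \<bullet> v a)\<^sup>2)" for b
    using integrable_inner_v_mult[OF t_meas bd, of b b] by (simp add: power2_eq_square)
  have \<mu>_pos: "0 < \<mu> b" if b: "b \<in> B" for b
  proof -
    have "(LINT a|M. l * (b \<bullet> v a)\<^sup>2) \<le> \<mu> b"
      unfolding \<mu>_int using l integrable_inner_v_sq
      by (intro integral_mono int_t integrable_mult_right mult_right_mono) auto
    then show ?thesis
      using l(1) B(3)[OF b] by (simp add: isotropic_v)
  qed
  have det: "det (matrix (frame_op t)) = (\<Prod>b\<in>B. \<mu> b)"
    by (rule det_orthonormal_eigenbasis[OF lin onb eig])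
  then show "0 < det (matrix (frame_op t))"
    using \<mu>_pos by (simp add: prod_pos)
  have ln_det: "ln (det (matrix (frame_op t))) = (\<Sum>b\<in>B. ln (\<mu> b))"
    unfolding det by (intro ln_prod fin) (metis \<mu>_pos less_irrefl)
  \<comment> \<open>the pointwise deficit in the logarithmic inequality, summed over the eigenbasis\<close>
  define slack where "slack a = (\<Sum>b\<in>B. (b \<bullet> v a)\<^sup>2 * (t a / \<mu> b - 1 - ln (t a / \<mu> b)))" for a
  have term_nonneg: "0 \<le> t a / \<mu> b - 1 - ln (t a / \<mu> b)" if "a \<in> space M" "b \<in> B" for a b
    using ln_le_minus_one[of "t a / \<mu> b"] tpos[OF that(1)] \<mu>_pos[OF that(2)] by simp
  have slack_nonneg: "0 \<le> slack a" if "a \<in> space M" for a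
    unfolding slack_def using term_nonneg[OF that] by (intro sum_nonneg mult_nonneg_nonneg) auto
  have int_ln: "integrable M (\<lambda>a. ln (t a))"
  proof (rule integrable_bounded)
    fix a assume a: "a \<in> space M"
    have "ln l \<le> ln (t a)" "ln (t a) \<le> ln u"
      using l(1) l(2)[OF a] u[OF a] tpos[OF a] by auto
    then show "norm (ln (t a)) \<le> \<bar>ln l\<bar> + \<bar>ln u\<bar>" by simp
  qed measurable
  have slack_eq: "slack a = (\<Sum>b\<in>B. t a * (b \<bullet> v a)\<^sup>2 / \<mu> b - (b \<bullet> v a)\<^sup>2 + (b \<bullet> v a)\<^sup>2 * ln (\<mu> b)) - ln (t a)"
    if a: "a \<in> space M" for a
  proof -
    have "slack a = (\<Sum>b\<in>B. (t a * (b \<bullet> v a)\<^sup>2 / \<mu> b - (b \<bullet> v a)\<^sup>2 + (b \<bullet> v a)\<^sup>2 * ln (\<mu> b))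
        - (b \<bullet> v a)\<^sup>2 * ln (t a))"
      unfolding slack_def
    proof (rule sum.cong[OF refl])
      fix b assume b: "b \<in> B"
      have "ln (t a / \<mu> b) = ln (t a) - ln (\<mu> b)"
        using tpos[OF a] \<mu>_pos[OF b] by (simp add: ln_div)
      then show "(b \<bullet> v a)\<^sup>2 * (t a / \<mu> b - 1 - ln (t a / \<mu> b)) =
          t a * (b \<bullet> v a)\<^sup>2 / \<mu> b - (b \<bullet> v a)\<^sup>2 + (b \<bullet> v a)\<^sup>2 * ln (\<mu> b) - (b \<bullet> v a)\<^sup>2 * ln (t a)"
        by (simp only:) (simp add: algebra_simps)
    qed
    moreover have "(\<Sum>b\<in>B. (b \<bullet> v a)\<^sup>2 * ln (t a)) = ln (t a)"
      using orthonormal_basis_parseval[OF onb, of "v a"] norm_v[OF a]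
      by (simp add: sum_distrib_right[symmetric] inner_commute)
    ultimately show ?thesis by (simp add: sum_subtractf)
  qed
  have int_terms: "integrable M (\<lambda>a. t a * (b \<bullet> v a)\<^sup>2 / \<mu> b - (b \<bullet> v a)\<^sup>2 + (b \<bullet> v a)\<^sup>2 * ln (\<mu> b))" for b
    using int_t[of b] integrable_inner_v_sq[of b] by auto
  have slack_integrable: "integrable M slack"
    by (subst Bochner_Integration.integrable_cong[OF refl slack_eq])
      (auto intro!: int_terms int_ln)
  have "(LINT a|M. slack a) = (\<Sum>b\<in>B. ln (\<mu> b)) - (LINT a|M. ln (t a))"
  proof -
    have "(LINT a|M. slack a) = (\<Sum>b\<in>B. LINT a|M. t a * (b \<bullet> v a)\<^sup>2 / \<mu> b - (b \<bullet> v a)\<^sup>2 + (b \<bullet> v a)\<^sup>2 * ln (\<mu> b))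
        - (LINT a|M. ln (t a))"
      by (simp add: Bochner_Integration.integral_cong[OF refl slack_eq] Bochner_Integration.integral_diff
          Bochner_Integration.integral_sum int_terms int_ln)
    also have "(\<Sum>b\<in>B. LINT a|M. t a * (b \<bullet> v a)\<^sup>2 / \<mu> b - (b \<bullet> v a)\<^sup>2 + (b \<bullet> v a)\<^sup>2 * ln (\<mu> b))
        = (\<Sum>b\<in>B. ln (\<mu> b))"
    proof (rule sum.cong[OF refl])
      fix b assume b: "b \<in> B"
      have "(LINT a|M. t a * (b \<bullet> v a)\<^sup>2 / \<mu> b - (b \<bullet> v a)\<^sup>2 + (b \<bullet> v a)\<^sup>2 * ln (\<mu> b))
          = \<mu> b / \<mu> b - (norm b)\<^sup>2 + (norm b)\<^sup>2 * ln (\<mu> b)"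
        using int_t[of b] integrable_inner_v_sq[of b]
        by (simp add: Bochner_Integration.integral_diff Bochner_Integration.integral_add \<mu>_int isotropic_v)
      then show "(LINT a|M. t a * (b \<bullet> v a)\<^sup>2 / \<mu> b - (b \<bullet> v a)\<^sup>2 + (b \<bullet> v a)\<^sup>2 * ln (\<mu> b)) = ln (\<mu> b)"
        using B(3)[OF b] \<mu>_pos[OF b] by simp
    qed
    finally show ?thesis .
  qed
  then have slack_int: "(LINT a|M. slack a) = ln (det (matrix (frame_op t))) - (LINT a|M. ln (t a))"
    by (simp add: ln_det)
  moreover have "0 \<le> (LINT a|M. slack a)"
    using slack_nonneg by (intro Bochner_Integration.integral_nonneg_AE) auto
  ultimately show "(LINT a|M. ln (t a)) \<le> ln (det (matrix (frame_op t)))" by simp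
  have "slack a = 0 \<longleftrightarrow> frame_op t (v a) = t a *\<^sub>R v a" if a: "a \<in> space M" for a
  proof -
    have "slack a = 0 \<longleftrightarrow> (\<forall>b\<in>B. (b \<bullet> v a)\<^sup>2 * (t a / \<mu> b - 1 - ln (t a / \<mu> b)) = 0)"
      unfolding slack_def using term_nonneg[OF a] fin by (intro sum_nonneg_eq_0_iff) auto
    also have "\<dots> \<longleftrightarrow> (\<forall>b\<in>B. frame_op t (v a) \<bullet> b = (t a *\<^sub>R v a) \<bullet> b)"
    proof (rule ball_cong[OF refl])
      fix b assume b: "b \<in> B"
      have "t a / \<mu> b - 1 - ln (t a / \<mu> b) = 0 \<longleftrightarrow> t a = \<mu> b"
        using ln_eq_minus_one[of "t a / \<mu> b"] tpos[OF a] \<mu>_pos[OF b] by auto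
      moreover have "frame_op t (v a) \<bullet> b = \<mu> b * (b \<bullet> v a)"
        using sa[of "v a" b] by (simp add: eig[OF b] inner_commute)
      ultimately show "((b \<bullet> v a)\<^sup>2 * (t a / \<mu> b - 1 - ln (t a / \<mu> b)) = 0)
          = (frame_op t (v a) \<bullet> b = (t a *\<^sub>R v a) \<bullet> b)"
        by (auto simp: inner_commute)
    qed
    also have "\<dots> \<longleftrightarrow> frame_op t (v a) = t a *\<^sub>R v a"
      using orthonormal_basis_expansion[OF onb, of "frame_op t (v a)"]
        orthonormal_basis_expansion[OF onb, of "t a *\<^sub>R v a"]
      by (metis (no_types, lifting) sum.cong)
    finally show ?thesis .
  qed
  then have "(AE a in M. slack a = 0) \<longleftrightarrow> (AE a in M. frame_op t (v a) = t a *\<^sub>R v a)"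
    by (intro AE_cong) auto
  moreover have "(LINT a|M. slack a) = 0 \<longleftrightarrow> (AE a in M. slack a = 0)"
    using slack_nonneg by (intro integral_nonneg_eq_0_iff_AE slack_integrable) auto
  ultimately show "(LINT a|M. ln (t a)) = ln (det (matrix (frame_op t)))
           \<longleftrightarrow> (AE a in M. frame_op t (v a) = t a *\<^sub>R v a)"
    using slack_int by auto
qed

end

section \<open>The transport map of an isotropic frame\<close>

text \<open>Change of variables for nonnegative real functions, where integrability and absolute integrability
  coincide; the vector-valued theorem is applied to functions with values in \<open>real ^ 1\<close>.\<close>

lemma has_integral_change_of_variables_nonneg:
  fixes f :: "real^'m::{finite,wellorder} \<Rightarrow> real" and g :: "real^'m::_ \<Rightarrow> real^'m::_"
  assumes der: "\<And>x. (g has_derivative g' x) (at x)" and inj: "inj g"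
    and nonneg: "\<And>x. 0 \<le> f x"
  shows "(f has_integral b) (range g)
    \<longleftrightarrow> ((\<lambda>x. \<bar>det (matrix (g' x))\<bar> * f (g x)) has_integral b) UNIV"
proof -
  have "(\<lambda>x. \<bar>det (matrix (g' x))\<bar> *\<^sub>R vec (f (g x)) :: real ^ 1) absolutely_integrable_on UNIV \<and>
         integral UNIV (\<lambda>x. \<bar>det (matrix (g' x))\<bar> *\<^sub>R vec (f (g x))) = (vec b :: real ^ 1)
     \<longleftrightarrow> (\<lambda>x. vec (f x) :: real ^ 1) absolutely_integrable_on range g
       \<and> integral (range g) (\<lambda>x. vec (f x)) = (vec b :: real ^ 1)"
    by (rule has_absolute_integral_change_of_variables) (use der inj in auto)
  then have "(\<lambda>x. \<bar>det (matrix (g' x))\<bar> * f (g x)) absolutely_integrable_on UNIV \<and>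
         integral UNIV (\<lambda>x. \<bar>det (matrix (g' x))\<bar> * f (g x)) = b
     \<longleftrightarrow> f absolutely_integrable_on range g \<and> integral (range g) f = b"
    by (simp add: absolutely_integrable_on_1_iff integral_on_1_eq)
  then show ?thesis
    by (simp add: absolutely_integrable_on_iff_nonneg nonneg has_integral_iff)
qed

text \<open>The index type of the coordinates is well-ordered here because the change of variables theorem asks
  for it.\<close>

locale transport_frame = isotropic_frame M v
  for M :: "'a measure" and v :: "'a \<Rightarrow> real^'m::{finite,wellorder}"
begin

definition transport :: "real^'m::_ \<Rightarrow> real^'m::_" where
  "transport y = (LINT a|M. gauss_exp_map (y \<bullet> v a) *\<^sub>R v a)"

lemma continuous_inner_v_measurable:
  "continuous_on UNIV f \<Longrightarrow> (\<lambda>a. f (y \<bullet> v a)) \<in> borel_measurable M"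
  for f :: "real \<Rightarrow> real"
  by (rule borel_measurable_continuous_on) measurable

lemma continuous_inner_v_bounds:
  fixes f :: "real \<Rightarrow> real"
  assumes cont: "continuous_on UNIV f"
  obtains p q where "\<And>a. a \<in> space M \<Longrightarrow> f p \<le> f (y \<bullet> v a)" "\<And>a. a \<in> space M \<Longrightarrow> f (y \<bullet> v a) \<le> f q"
proof -
  have c: "compact {- norm y..norm y}" "{- norm y..norm y} \<noteq> {}" "continuous_on {- norm y..norm y} f"
    using continuous_on_subset[OF cont] by auto
  obtain p where p: "\<And>s. s \<in> {- norm y..norm y} \<Longrightarrow> f p \<le> f s"
    using continuous_attains_inf[OF c] by blast
  obtain q where q: "\<And>s. s \<in> {- norm y..norm y} \<Longrightarrow> f s \<le> f q"
    using continuous_attains_sup[OF c] by blast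
  have "y \<bullet> v a \<in> {- norm y..norm y}" if "a \<in> space M" for a
    using inner_v_le[OF that, of y] by auto
  then show ?thesis using p q by (intro that) auto
qed

lemma continuous_inner_v_bounded:
  fixes f :: "real \<Rightarrow> real"
  assumes cont: "continuous_on UNIV f"
  obtains B where "\<And>a. a \<in> space M \<Longrightarrow> \<bar>f (y \<bullet> v a)\<bar> \<le> B"
proof -
  obtain p q where "\<And>a. a \<in> space M \<Longrightarrow> f p \<le> f (y \<bullet> v a)" "\<And>a. a \<in> space M \<Longrightarrow> f (y \<bullet> v a) \<le> f q"
    using continuous_inner_v_bounds[OF cont] by blast
  then have "\<bar>f (y \<bullet> v a)\<bar> \<le> \<bar>f p\<bar> + \<bar>f q\<bar>" if "a \<in> space M" for a
    using that by fastforce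
  then show ?thesis by (rule that)
qed

lemma integrable_continuous_inner_v:
  fixes f :: "real \<Rightarrow> real"
  assumes cont: "continuous_on UNIV f"
  shows "integrable M (\<lambda>a. f (y \<bullet> v a))" "integrable M (\<lambda>a. f (y \<bullet> v a) *\<^sub>R v a)"
proof -
  obtain B where B: "\<And>a. a \<in> space M \<Longrightarrow> \<bar>f (y \<bullet> v a)\<bar> \<le> B"
    using continuous_inner_v_bounded[OF cont] by blast
  show "integrable M (\<lambda>a. f (y \<bullet> v a))"
    using B by (intro integrable_bounded[where B = B] continuous_inner_v_measurable cont) auto
  show "integrable M (\<lambda>a. f (y \<bullet> v a) *\<^sub>R v a)"
    using B by (intro integrable_scaleR_v[where B = B] continuous_inner_v_measurable cont) auto
qed

lemma inner_transport: "x \<bullet> transport y = (LINT a|M. gauss_exp_map (y \<bullet> v a) * (x \<bullet> v a))"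
proof -
  have cont: "continuous_on UNIV gauss_exp_map" by (rule continuous_on_gauss_exp_map)
  obtain B where B: "\<And>a. a \<in> space M \<Longrightarrow> \<bar>gauss_exp_map (y \<bullet> v a)\<bar> \<le> B"
    using continuous_inner_v_bounded[OF cont] by blast
  show ?thesis
    unfolding transport_def
    by (rule inner_integral_scaleR_v[OF continuous_inner_v_measurable[OF cont] B])
qed

abbreviation transport_deriv :: "real^'m::_ \<Rightarrow> real^'m::_ \<Rightarrow> real^'m::_" where
  "transport_deriv y \<equiv> frame_op (\<lambda>a. gauss_exp_deriv (y \<bullet> v a))"

lemma transport_has_derivative: "(transport has_derivative transport_deriv y) (at y)"
proof -
  let ?t = "\<lambda>a. gauss_exp_deriv (y \<bullet> v a)"
  have cont: "continuous_on UNIV gauss_exp_map" "continuous_on UNIV gauss_exp_deriv"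
    by (rule continuous_on_gauss_exp_map continuous_on_gauss_exp_deriv)+
  note meas [measurable] = continuous_inner_v_measurable[OF cont(2), of y]
  obtain B where B: "\<And>a. a \<in> space M \<Longrightarrow> \<bar>?t a\<bar> \<le> B"
    using continuous_inner_v_bounded[OF cont(2)] by blast
  have lin: "linear (transport_deriv y)"
    by (rule linear_frame_op[OF meas B])
  have "\<exists>d>0. \<forall>z. norm (z - y) < d \<longrightarrow>
      norm (transport z - transport y - transport_deriv y (z - y)) \<le> e * norm (z - y)" if e: "0 < e" for e
  proof -
    have e': "0 < e / real CARD('m)" using e by simp
    \<comment> \<open>the tolerance is divided by the total mass of the frame, which is the dimension\<close>
    obtain d where d: "0 < d" and lin_close:
      "\<And>p q. \<lbrakk>\<bar>p\<bar> \<le> norm y; \<bar>q - p\<bar> < d\<rbrakk> \<Longrightarrow>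
        \<bar>gauss_exp_map q - gauss_exp_map p - gauss_exp_deriv p * (q - p)\<bar> \<le> e / real CARD('m) * \<bar>q - p\<bar>"
      using gauss_exp_map_uniform_linearization[OF e', of "norm y"] by blast
    have "norm (transport z - transport y - transport_deriv y (z - y)) \<le> e * norm (z - y)"
      if z: "norm (z - y) < d" for z
    proof -
      let ?r = "\<lambda>a. gauss_exp_map (z \<bullet> v a) - gauss_exp_map (y \<bullet> v a) - ?t a * ((z - y) \<bullet> v a)"
      have int3: "integrable M (\<lambda>a. (?t a * ((z - y) \<bullet> v a)) *\<^sub>R v a)"
        by (rule integrable_scaleR_v[OF _ frame_op_bound[OF meas B]]) auto
      have "transport z - transport y - transport_deriv y (z - y) = (LINT a|M. ?r a *\<^sub>R v a)"
        unfolding transport_def frame_op_def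
        by (simp add: Bochner_Integration.integral_diff integrable_continuous_inner_v[OF cont(1)] int3
            scaleR_diff_left)
      moreover have "norm (LINT a|M. ?r a *\<^sub>R v a) \<le> (LINT a|M. e / real CARD('m) * norm (z - y))"
      proof (rule order_trans[OF integral_norm_bound integral_mono])
        show "integrable M (\<lambda>a. norm (?r a *\<^sub>R v a))"
          using integrable_continuous_inner_v(2)[OF cont(1)] int3
          by (intro integrable_norm) (simp add: scaleR_diff_left)
        fix a assume a: "a \<in> space M"
        have "\<bar>(z - y) \<bullet> v a\<bar> \<le> norm (z - y)" "\<bar>y \<bullet> v a\<bar> \<le> norm y"
          using inner_v_le[OF a] by auto
        then have "\<bar>?r a\<bar> \<le> e / real CARD('m) * \<bar>(z - y) \<bullet> v a\<bar>"
          using lin_close[of "y \<bullet> v a" "z \<bullet> v a"] z by (simp add: inner_diff_left)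
        also have "\<dots> \<le> e / real CARD('m) * norm (z - y)"
          using inner_v_le[OF a] e by (intro mult_left_mono) auto
        finally show "norm (?r a *\<^sub>R v a) \<le> e / real CARD('m) * norm (z - y)"
          using norm_v[OF a] by simp
      qed auto
      ultimately show ?thesis by (simp add: total_mass)
    qed
    then show ?thesis using d by blast
  qed
  then show ?thesis
    using lin by (simp add: has_derivative_at_alt linear_conv_bounded_linear)
qed

text \<open>The transport map is strictly monotone: its increment paired with \<open>y - z\<close> is an integral of
  nonnegative numbers \<open>(T p - T q) (p - q)\<close>, which can vanish only if \<open>y - z\<close> is orthogonal to almost
  every frame vector and hence zero.\<close>

lemma inj_transport: "inj transport"
proof (rule injI)
  fix y z assume eq: "transport y = transport z"
  let ?f = "\<lambda>a. (gauss_exp_map (y \<bullet> v a) - gauss_exp_map (z \<bullet> v a)) * ((y - z) \<bullet> v a)"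
  have cont: "continuous_on UNIV gauss_exp_map" by (rule continuous_on_gauss_exp_map)
  have mono: "(gauss_exp_map p - gauss_exp_map q) * (p - q) \<ge> 0"
    "(gauss_exp_map p - gauss_exp_map q) * (p - q) = 0 \<Longrightarrow> p = q" for p q
    using gauss_exp_map_strict_mono[of p q] gauss_exp_map_strict_mono[of q p]
    by (cases p q rule: linorder_cases; force simp: mult_nonpos_nonpos)+
  have int: "integrable M (\<lambda>a. gauss_exp_map (w \<bullet> v a) * ((y - z) \<bullet> v a))" for w
    using integrable_inner_right[OF integrable_continuous_inner_v(2)[OF cont, of w], of "y - z"] by simp
  have "(LINT a|M. ?f a) = (y - z) \<bullet> transport y - (y - z) \<bullet> transport z"
    by (simp add: inner_transport left_diff_distrib Bochner_Integration.integral_diff int)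
  then have zero: "(LINT a|M. ?f a) = 0" by (simp add: eq)
  have "integrable M ?f" using int by (simp add: left_diff_distrib)
  moreover have "AE a in M. 0 \<le> ?f a" using mono(1) by (simp add: inner_diff_left)
  ultimately have "AE a in M. ?f a = 0"
    using integral_nonneg_eq_0_iff_AE[of M ?f] zero by blast
  then have "AE a in M. (y - z) \<bullet> v a = 0"
  proof (rule eventually_mono)
    fix a assume "?f a = 0"
    then have "y \<bullet> v a = z \<bullet> v a" unfolding inner_diff_left by (rule mono(2))
    then show "(y - z) \<bullet> v a = 0" by (simp add: inner_diff_left)
  qed
  then show "y = z" using AE_inner_zero_imp[of "y - z"] by simp
qed

lemma open_range_transport: "open (range transport)"
  by (rule invariance_of_domain)
    (auto intro!: inj_transport has_derivative_continuous_on transport_has_derivative)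

lemma transport_det_bounds:
  shows transport_det_pos: "0 < det (matrix (transport_deriv y))"
    and transport_ln_det_ge: "(LINT a|M. ln (gauss_exp_deriv (y \<bullet> v a))) \<le> ln (det (matrix (transport_deriv y)))"
    and transport_ln_det_eq_iff:
      "(LINT a|M. ln (gauss_exp_deriv (y \<bullet> v a))) = ln (det (matrix (transport_deriv y)))
        \<longleftrightarrow> (AE a in M. transport_deriv y (v a) = gauss_exp_deriv (y \<bullet> v a) *\<^sub>R v a)"
proof -
  have cont: "continuous_on UNIV gauss_exp_deriv" by (rule continuous_on_gauss_exp_deriv)
  obtain p q where pq: "\<And>a. a \<in> space M \<Longrightarrow> gauss_exp_deriv p \<le> gauss_exp_deriv (y \<bullet> v a)"
    "\<And>a. a \<in> space M \<Longrightarrow> gauss_exp_deriv (y \<bullet> v a) \<le> gauss_exp_deriv q"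
    using continuous_inner_v_bounds[OF cont] by blast
  note * = frame_det_bound[OF continuous_inner_v_measurable[OF cont] gauss_exp_deriv_pos pq]
  show "0 < det (matrix (transport_deriv y))" by (rule *(1))
  show "(LINT a|M. ln (gauss_exp_deriv (y \<bullet> v a))) \<le> ln (det (matrix (transport_deriv y)))" by (rule *(2))
  show "(LINT a|M. ln (gauss_exp_deriv (y \<bullet> v a))) = ln (det (matrix (transport_deriv y)))
        \<longleftrightarrow> (AE a in M. transport_deriv y (v a) = gauss_exp_deriv (y \<bullet> v a) *\<^sub>R v a)" by (rule *(3))
qed

text \<open>The Gaussian is the one density for which the averaged one-dimensional logarithms reassemble to the
  logarithm of the product density: the quadratic terms add up by isotropy and the constants by the
  total mass of the frame.\<close>

lemma integral_ln_std_normal: "(LINT a|M. ln (std_normal_density (y \<bullet> v a))) = ln (std_normal_vec y)"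
proof -
  have ln_eq: "ln (std_normal_density s) = - ln (sqrt (2 * pi)) - s\<^sup>2 / 2" for s
    by (simp add: std_normal_density_def ln_mult ln_div)
  have "(LINT a|M. ln (std_normal_density (y \<bullet> v a))) = - real CARD('m) * ln (sqrt (2 * pi)) - (norm y)\<^sup>2 / 2"
    by (simp add: ln_eq Bochner_Integration.integral_diff integrable_inner_v_sq isotropic_v total_mass)
  also have "\<dots> = (\<Sum>b\<in>Basis. - ln (sqrt (2 * pi)) - (y \<bullet> b)\<^sup>2 / 2)"
  proof -
    have "(norm y)\<^sup>2 = (\<Sum>b\<in>Basis. (y \<bullet> b)\<^sup>2)"
      unfolding power2_norm_eq_inner by (subst euclidean_inner) (simp add: power2_eq_square)
    then show ?thesis by (simp add: sum_subtractf sum_divide_distrib[symmetric])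
  qed
  also have "\<dots> = ln (std_normal_vec y)"
    unfolding std_normal_vec_def
    by (subst ln_prod) (auto simp: ln_eq[symmetric] normal_density_pos[of 1, THEN less_imp_neq, symmetric])
  finally show ?thesis .
qed

context
  fixes w :: "real^'m::_"
  assumes w: "\<And>a. a \<in> space M \<Longrightarrow> w \<bullet> v a = 1"
begin

text \<open>As \<open>w \<bullet> v a = 1\<close> on the frame, the exponent \<open>w \<bullet> transport y\<close> is the
  integral of \<open>T (y \<bullet> v a)\<close> and cancels the same integral in \<open>\<integral> ln T' = \<integral> (ln g + T)\<close>, where \<open>g\<close> is the Gaussian
  density. What remains is the Gaussian plus the deficit in the determinant inequality.\<close>

lemma ln_transport_density:
  "ln (det (matrix (transport_deriv y)) * exp (- (w \<bullet> transport y)))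
    = ln (std_normal_vec y) + (ln (det (matrix (transport_deriv y))) - (LINT a|M. ln (gauss_exp_deriv (y \<bullet> v a))))"
proof -
  have cont: "continuous_on UNIV gauss_exp_map" "continuous_on UNIV (\<lambda>s. ln (std_normal_density s))"
    using continuous_on_gauss_exp_map normal_density_pos[of 1 0]
    by (auto intro!: continuous_intros simp: normal_density_def)
  have "(LINT a|M. ln (gauss_exp_deriv (y \<bullet> v a)))
      = ln (std_normal_vec y) + (LINT a|M. gauss_exp_map (y \<bullet> v a))"
    by (simp add: ln_gauss_exp_deriv integral_ln_std_normal[symmetric] Bochner_Integration.integral_add
        integrable_continuous_inner_v[OF cont(1)] integrable_continuous_inner_v[OF cont(2)])
  moreover have "w \<bullet> transport y = (LINT a|M. gauss_exp_map (y \<bullet> v a))"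
    unfolding inner_transport by (intro Bochner_Integration.integral_cong) (auto simp: w)
  ultimately show ?thesis
    using transport_det_pos[of y] by (simp add: ln_mult)
qed

lemma transport_density_ge:
  "std_normal_vec y \<le> det (matrix (transport_deriv y)) * exp (- (w \<bullet> transport y))"
  and transport_density_eq_iff:
  "std_normal_vec y = det (matrix (transport_deriv y)) * exp (- (w \<bullet> transport y))
    \<longleftrightarrow> (AE a in M. transport_deriv y (v a) = gauss_exp_deriv (y \<bullet> v a) *\<^sub>R v a)"
proof -
  let ?h = "det (matrix (transport_deriv y)) * exp (- (w \<bullet> transport y))"
  have pos: "0 < ?h" "0 < std_normal_vec y"
    using transport_det_pos[of y] std_normal_vec_pos[of y] by auto
  have "ln (std_normal_vec y) \<le> ln ?h"
    using transport_ln_det_ge[of y] by (simp add: ln_transport_density)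
  then show "std_normal_vec y \<le> ?h" using pos by (simp only: ln_le_cancel_iff)
  have "std_normal_vec y = ?h \<longleftrightarrow> ln (std_normal_vec y) = ln ?h"
    using pos by (simp only: ln_inj_iff)
  also have "\<dots> \<longleftrightarrow> (LINT a|M. ln (gauss_exp_deriv (y \<bullet> v a))) = ln (det (matrix (transport_deriv y)))"
    by (auto simp: ln_transport_density)
  finally show "std_normal_vec y = ?h
    \<longleftrightarrow> (AE a in M. transport_deriv y (v a) = gauss_exp_deriv (y \<bullet> v a) *\<^sub>R v a)"
    by (simp only: transport_ln_det_eq_iff)
qed

lemma has_integral_range_transport:
  "((\<lambda>x. exp (- (w \<bullet> x))) has_integral b) (range transport) \<longleftrightarrow>
   ((\<lambda>y. det (matrix (transport_deriv y)) * exp (- (w \<bullet> transport y))) has_integral b) UNIV"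
  using has_integral_change_of_variables_nonneg[OF transport_has_derivative inj_transport, of "\<lambda>x. exp (- (w \<bullet> x))" b]
    transport_det_pos
  by (simp add: abs_of_pos)

lemma transport_integral_ge_1:
  assumes int: "((\<lambda>x. exp (- (w \<bullet> x))) has_integral b) (range transport)"
  shows "1 \<le> b"
  by (rule has_integral_le[OF has_integral_std_normal_vec int[unfolded has_integral_range_transport] transport_density_ge])

lemma transport_integral_eq_1_imp:
  assumes int: "((\<lambda>x. exp (- (w \<bullet> x))) has_integral 1) (range transport)"
  shows "AE y in lebesgue. AE a in M. transport_deriv y (v a) = gauss_exp_deriv (y \<bullet> v a) *\<^sub>R v a"
proof -
  let ?d = "\<lambda>y. det (matrix (transport_deriv y)) * exp (- (w \<bullet> transport y)) - std_normal_vec y"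
  have nn: "0 \<le> ?d y" for y using transport_density_ge[of y] by simp
  have "(?d has_integral 1 - 1) UNIV"
    by (intro has_integral_diff int[unfolded has_integral_range_transport] has_integral_std_normal_vec)
  then have "?d \<in> borel_measurable lebesgue" "integral\<^sup>N lebesgue ?d = 0"
    using has_integral_iff_nn_integral_lebesgue[of ?d 0, OF nn] by simp_all
  then have "AE y in lebesgue. ennreal (?d y) = 0"
    by (subst nn_integral_0_iff_AE[symmetric]) auto
  then show ?thesis
  proof (rule eventually_mono)
    fix y assume "ennreal (?d y) = 0"
    then have "std_normal_vec y = det (matrix (transport_deriv y)) * exp (- (w \<bullet> transport y))"
      using nn[of y] by (simp add: ennreal_eq_0_iff)
    then show "AE a in M. transport_deriv y (v a) = gauss_exp_deriv (y \<bullet> v a) *\<^sub>R v a"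
      by (simp only: transport_density_eq_iff)
  qed
qed

lemma transport_integral_eq_1I:
  assumes "\<And>y. AE a in M. transport_deriv y (v a) = gauss_exp_deriv (y \<bullet> v a) *\<^sub>R v a"
  shows "((\<lambda>x. exp (- (w \<bullet> x))) has_integral 1) (range transport)"
proof -
  have "std_normal_vec = (\<lambda>y. det (matrix (transport_deriv y)) * exp (- (w \<bullet> transport y)))"
    using assms by (intro ext) (simp only: transport_density_eq_iff)
  then show ?thesis
    using has_integral_std_normal_vec by (simp only: has_integral_range_transport)
qed

end

end

section \<open>Homogeneous coordinates and the integral over a cone\<close>

text \<open>Coordinates of \<open>\<real> \<times> \<real>\<^sup>n\<close>: \<open>None\<close> is the height and \<open>Some j\<close> the \<open>j\<close>-th coordinate of the base. A
  type of its own is introduced in order to equip it with a well-order without touching \<open>option\<close>.\<close>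

typedef 'n homog = "UNIV :: 'n option set" ..

instance homog :: (finite) finite
proof
  have "UNIV = range (Abs_homog :: 'a::finite option \<Rightarrow> 'a homog)"
    by (simp add: type_definition.Abs_image[OF type_definition_homog])
  moreover have "finite (range (Abs_homog :: 'a::finite option \<Rightarrow> 'a homog))"
    by (intro finite_imageI finite)
  ultimately show "finite (UNIV :: 'a::finite homog set)" by (simp only:)
qed

text \<open>An arbitrary enumeration, used only to transfer the well-order of the natural numbers.\<close>

definition homog_rank :: "'n::finite homog \<Rightarrow> nat" where
  "homog_rank = (SOME f. inj f)"

lemma inj_homog_rank: "inj (homog_rank :: 'a::finite homog \<Rightarrow> nat)"
proof -
  have "\<exists>f :: 'a homog \<Rightarrow> nat. inj f"
    using finite_imp_inj_to_nat_seg[OF finite, of "UNIV :: 'a homog set"] by blast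
  then show ?thesis unfolding homog_rank_def by (rule someI_ex)
qed

instantiation homog :: (finite) wellorder
begin

definition less_eq_homog :: "'a homog \<Rightarrow> 'a homog \<Rightarrow> bool" where
  "less_eq_homog x y \<longleftrightarrow> homog_rank x \<le> homog_rank y"

definition less_homog :: "'a homog \<Rightarrow> 'a homog \<Rightarrow> bool" where
  "less_homog x y \<longleftrightarrow> homog_rank x < homog_rank y"

instance
proof
  fix P :: "'a homog \<Rightarrow> bool" and x
  assume step: "\<And>x. (\<And>y. y < x \<Longrightarrow> P y) \<Longrightarrow> P x"
  show "P x"
  proof (induction x rule: measure_induct_rule[of homog_rank])
    case (less x)
    show ?case by (rule step, rule less.IH) (simp add: less_homog_def)
  qed
qed (auto simp: less_eq_homog_def less_homog_def dest: injD[OF inj_homog_rank])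

end

lemma UNIV_homog: "(UNIV :: 'n homog set) = insert (Abs_homog None) ((\<lambda>j. Abs_homog (Some j)) ` UNIV)"
proof -
  have "(UNIV :: 'n homog set) = Abs_homog ` UNIV"
    by (simp only: type_definition.Abs_image[OF type_definition_homog])
  also have "\<dots> = insert (Abs_homog None) ((\<lambda>j. Abs_homog (Some j)) ` UNIV)"
    by (simp only: UNIV_option_conv image_insert image_image)
  finally show ?thesis .
qed

lemma all_homog_iff: "(\<forall>i. P i) \<longleftrightarrow> P (Abs_homog None) \<and> (\<forall>j. P (Abs_homog (Some j)))"
proof -
  have "(\<forall>i\<in>UNIV. P i) \<longleftrightarrow> P (Abs_homog None) \<and> (\<forall>j. P (Abs_homog (Some j)))"
    by (subst UNIV_homog) blast
  then show ?thesis by simp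
qed

lemma Abs_homog_eq_iff [simp]: "Abs_homog x = Abs_homog y \<longleftrightarrow> x = y"
  by (simp add: Abs_homog_inject)

lemma sum_homog: "(\<Sum>i\<in>UNIV. f i) = f (Abs_homog None) + (\<Sum>j\<in>UNIV. f (Abs_homog (Some j)))"
  for f :: "'n::finite homog \<Rightarrow> 'b::comm_monoid_add"
  by (subst UNIV_homog, subst sum.insert) (auto simp: sum.reindex inj_on_def)

lemma prod_homog: "(\<Prod>i\<in>UNIV. f i) = f (Abs_homog None) * (\<Prod>j\<in>UNIV. f (Abs_homog (Some j)))"
  for f :: "'n::finite homog \<Rightarrow> 'b::comm_monoid_mult"
  by (subst UNIV_homog, subst prod.insert) (auto simp: prod.reindex inj_on_def)

lemma card_homog: "CARD('n::finite homog) = CARD('n) + 1"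
  using sum_homog[of "\<lambda>_. 1 :: nat"] by simp

definition homog :: "real \<times> (real^'n) \<Rightarrow> real^'n::finite homog" where
  "homog p = (\<chi> i. case Rep_homog i of None \<Rightarrow> fst p | Some j \<Rightarrow> snd p $ j)"

lemma homog_nth [simp]:
  "homog p $ Abs_homog None = fst p" "homog p $ Abs_homog (Some j) = snd p $ j"
  by (simp_all add: homog_def Abs_homog_inverse)

lemma inner_homog: "homog p \<bullet> homog q = fst p * fst q + snd p \<bullet> snd q"
  by (simp add: inner_vec_def sum_homog)

lemma vec_homog_eq_iff: "x = y \<longleftrightarrow> x $ Abs_homog None = y $ Abs_homog None \<and> (\<forall>j. x $ Abs_homog (Some j) = y $ Abs_homog (Some j))"
  for x y :: "real^'n::finite homog"
  unfolding vec_eq_iff by (rule all_homog_iff)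

lemma bij_homog: "bij (homog :: real \<times> (real^'n) \<Rightarrow> _)"
proof (rule bijI)
  show "inj (homog :: real \<times> (real^'n) \<Rightarrow> _)"
    by (rule injI) (auto simp: vec_homog_eq_iff prod_eq_iff vec_eq_iff)
  show "surj (homog :: real \<times> (real^'n) \<Rightarrow> _)"
  proof (rule surjI)
    fix x :: "real^'n homog"
    show "homog (x $ Abs_homog None, \<chi> j. x $ Abs_homog (Some j)) = x"
      by (simp add: vec_homog_eq_iff)
  qed
qed

lemma linear_homog: "linear homog"
  by (rule linearI) (auto simp: vec_homog_eq_iff)

lemma prod_Basis_vec: "(\<Prod>b\<in>Basis. x \<bullet> b) = (\<Prod>i\<in>UNIV. x $ i)" for x :: "real^'n"
proof -
  have B: "(Basis :: (real^'n) set) = (\<lambda>i. axis i 1) ` UNIV"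
    by (auto simp: Basis_vec_def)
  show ?thesis
    unfolding B by (simp add: prod.reindex inj_on_def axis_eq_axis inner_axis)
qed

lemma homog_measurable [measurable]: "homog \<in> borel_measurable borel"
  by (intro borel_measurable_continuous_onI linear_continuous_on)
    (simp add: linear_homog linear_conv_bounded_linear[symmetric])

text \<open>The isometry \<open>homog\<close> maps coordinate boxes to coordinate boxes, and Lebesgue measure is determined by its
  values on boxes.\<close>

lemma lborel_homog: "(lborel :: (real^'n::finite homog) measure) = distr lborel borel homog"
proof (rule lborel_eqI)
  fix l u :: "real^'n::finite homog"
  assume le: "\<And>b. b \<in> Basis \<Longrightarrow> l \<bullet> b \<le> u \<bullet> b"
  have le': "l $ i \<le> u $ i" for i
    using le[of "axis i 1"] by (simp add: inner_axis axis_in_Basis_iff)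
  let ?l = "\<chi> j. l $ Abs_homog (Some j)" and ?u = "\<chi> j. u $ Abs_homog (Some j)"
  have "homog -` box l u = box (l $ Abs_homog None) (u $ Abs_homog None) \<times> box ?l ?u"
  proof -
    have "homog p \<in> box l u \<longleftrightarrow> p \<in> box (l $ Abs_homog None) (u $ Abs_homog None) \<times> box ?l ?u" for p
    proof -
      show ?thesis
        unfolding mem_box_cart mem_Times_iff all_homog_iff by (simp add: mem_box_cart)
    qed
    then show ?thesis by auto
  qed
  then have "emeasure (distr lborel borel homog) (box l u)
      = emeasure lborel (box (l $ Abs_homog None) (u $ Abs_homog None) \<times> box ?l ?u)"
    by (subst emeasure_distr) auto
  also have "\<dots> = emeasure lborel (box (l $ Abs_homog None) (u $ Abs_homog None)) * emeasure lborel (box ?l ?u)"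
    by (subst lborel_prod[symmetric], subst lborel.emeasure_pair_measure_Times) auto
  also have "\<dots> = ennreal (u $ Abs_homog None - l $ Abs_homog None) * ennreal (\<Prod>b\<in>Basis. (?u - ?l) \<bullet> b)"
    using le' by (subst (2) emeasure_lborel_box) (auto simp: Basis_vec_def inner_axis)
  also have "\<dots> = ennreal ((u $ Abs_homog None - l $ Abs_homog None) * (\<Prod>j\<in>UNIV. (u - l) $ Abs_homog (Some j)))"
    using le' by (subst prod_Basis_vec) (simp add: ennreal_mult[symmetric] prod_nonneg)
  also have "\<dots> = ennreal (\<Prod>b\<in>Basis. (u - l) \<bullet> b)"
    by (simp add: prod_Basis_vec prod_homog)
  finally show "emeasure (distr lborel borel homog) (box l u) = (\<Prod>b\<in>Basis. (u - l) \<bullet> b)" .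
qed simp

text \<open>The open cone whose slice at height \<open>s\<close> is \<open>r s K\<close>.\<close>

definition cone_over :: "real \<Rightarrow> (real^'n) set \<Rightarrow> (real^'n::finite homog) set" where
  "cone_over r K = {homog (s, (r * s) *\<^sub>R k) | s k. 0 < s \<and> k \<in> K}"

lemma homog_in_cone_over_iff:
  assumes "0 < r"
  shows "homog (s, z) \<in> cone_over r K \<longleftrightarrow> 0 < s \<and> (1 / (r * s)) *\<^sub>R z \<in> K"
proof
  assume "homog (s, z) \<in> cone_over r K"
  then obtain k where "0 < s" "k \<in> K" "z = (r * s) *\<^sub>R k"
    unfolding cone_over_def by (auto simp: inj_eq[OF bij_is_inj[OF bij_homog]])
  then show "0 < s \<and> (1 / (r * s)) *\<^sub>R z \<in> K" using assms by simp
next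
  assume *: "0 < s \<and> (1 / (r * s)) *\<^sub>R z \<in> K"
  then have "z = (r * s) *\<^sub>R ((1 / (r * s)) *\<^sub>R z)" using assms by simp
  with * show "homog (s, z) \<in> cone_over r K"
    unfolding cone_over_def by (intro CollectI exI[of _ s] exI[of _ "(1 / (r * s)) *\<^sub>R z"]) auto
qed

lemma emeasure_scaled:
  fixes K :: "(real^'n) set"
  assumes K: "compact K" and m: "0 < m"
  shows "emeasure lborel {z. (1 / m) *\<^sub>R z \<in> K} = ennreal (m ^ CARD('n) * measure lebesgue K)"
proof -
  have eq: "{z. (1 / m) *\<^sub>R z \<in> K} = (\<lambda>z. m *\<^sub>R z + 0) ` K"
  proof (intro equalityI subsetI)
    fix z assume "z \<in> {z. (1 / m) *\<^sub>R z \<in> K}"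
    moreover have "z = m *\<^sub>R ((1 / m) *\<^sub>R z) + 0" using m by simp
    ultimately show "z \<in> (\<lambda>z. m *\<^sub>R z + 0) ` K" by blast
  qed (use m in auto)
  have "compact ((\<lambda>z. m *\<^sub>R z + 0) ` K)"
    using K by (intro compact_continuous_image continuous_intros)
  then have "emeasure lborel ((\<lambda>z. m *\<^sub>R z + 0) ` K) = emeasure lebesgue ((\<lambda>z. m *\<^sub>R z + 0) ` K)"
    by (simp add: borel_compact)
  also have "\<dots> = ennreal (m ^ CARD('n)) * emeasure lebesgue K"
    using m emeasure_lebesgue_affine[of m 0 K] by (simp add: ennreal_power)
  also have "emeasure lebesgue K = ennreal (measure lebesgue K)"
    using K lmeasurable_compact by (intro emeasure_eq_measure2) auto
  finally show ?thesis using m eq by (simp add: ennreal_mult)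
qed

text \<open>By Fubini the integral is \<open>\<integral> exp (- c s) (r s)\<^sup>n \<bar>K\<bar> ds\<close>, a Gamma integral; it is evaluated by
  recognising the density of the Erlang distribution.\<close>

lemma has_integral_cone_over:
  fixes K :: "(real^'n) set"
  assumes K: "compact K" and r: "0 < r" and c: "0 < c"
  shows "((\<lambda>x. exp (- (homog (c, 0) \<bullet> x))) has_integral
           measure lebesgue K * (r ^ CARD('n) * fact CARD('n) / c ^ (CARD('n) + 1))) (cone_over r K)"
proof -
  let ?n = "CARD('n)"
  let ?F = "\<lambda>x. if x \<in> cone_over r K then exp (- (homog (c, 0) \<bullet> x)) else 0 :: real"
  let ?I = "measure lebesgue K * (r ^ ?n * fact ?n / c ^ (?n + 1))"
  have Kb: "K \<in> sets borel" using K by (rule borel_compact)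
  let ?D = "{p. 0 < fst p \<and> (1 / (r * fst p)) *\<^sub>R snd p \<in> K}"
  have [measurable]: "(fst :: real \<times> (real^'n) \<Rightarrow> _) \<in> borel_measurable borel"
    "(snd :: real \<times> (real^'n) \<Rightarrow> _) \<in> borel_measurable borel"
    by (intro borel_measurable_continuous_onI continuous_intros)+
  have D: "?D \<in> sets borel"
  proof -
    have "(\<lambda>p :: real \<times> (real^'n). (1 / (r * fst p)) *\<^sub>R snd p) \<in> borel_measurable borel"
      by measurable
    from measurable_sets[OF this Kb] have "{p :: real \<times> (real^'n). (1 / (r * fst p)) *\<^sub>R snd p \<in> K} \<in> sets borel"
      by (simp add: vimage_def)
    moreover have "{p :: real \<times> (real^'n). 0 < fst p} \<in> sets borel" by measurable
    ultimately have "{p :: real \<times> (real^'n). 0 < fst p} \<inter> {p. (1 / (r * fst p)) *\<^sub>R snd p \<in> K} \<in> sets borel"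
      by (rule sets.Int[rotated])
    then show ?thesis by (simp add: Int_def)
  qed
  have F_homog: "?F (homog p) = indicator ?D p * exp (- (c * fst p))" for p
    using homog_in_cone_over_iff[OF r, of "fst p" "snd p" K, unfolded prod.collapse] by (simp add: inner_homog)
  have cone_b: "cone_over r K \<in> sets borel"
  proof -
    let ?g = "\<lambda>x :: real^'n::finite homog. (x $ Abs_homog None, \<chi> j. x $ Abs_homog (Some j))"
    have "linear ?g" by (rule linearI) (auto simp: vec_eq_iff)
    then have "?g \<in> borel_measurable borel"
      by (intro borel_measurable_continuous_onI linear_continuous_on)
        (simp add: linear_conv_bounded_linear[symmetric])
    from measurable_sets[OF this D] have "?g -` ?D \<in> sets borel" by simp
    moreover have "homog (?g x) = x" for x by (simp add: vec_homog_eq_iff)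
    then have "?g -` ?D = cone_over r K"
      unfolding set_eq_iff vimage_eq using homog_in_cone_over_iff[OF r]
      by (metis (mono_tags, lifting) fst_conv mem_Collect_eq snd_conv)
    ultimately show ?thesis by simp
  qed
  have F_b: "?F \<in> borel_measurable borel"
    using cone_b by (intro measurable_If_set) auto
  have "(\<integral>\<^sup>+x. ennreal (?F x) \<partial>lborel) = (\<integral>\<^sup>+p. ennreal (?F (homog p)) \<partial>lborel)"
    by (subst lborel_homog, subst nn_integral_distr) (use F_b in auto)
  also have "\<dots> = (\<integral>\<^sup>+p. ennreal (indicator ?D p * exp (- (c * fst p))) \<partial>(lborel \<Otimes>\<^sub>M lborel))"
    by (simp only: F_homog lborel_prod)
  also have "\<dots> = (\<integral>\<^sup>+s. (\<integral>\<^sup>+z. ennreal (indicator ?D (s, z) * exp (- (c * fst (s, z)))) \<partial>lborel) \<partial>lborel)"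
    using D by (intro lborel.nn_integral_fst[symmetric]) (simp add: lborel_prod)
  also have "\<dots> = (\<integral>\<^sup>+s. ennreal ?I * ennreal (erlang_density ?n c s) \<partial>lborel)"
  proof (rule nn_integral_cong)
    fix s :: real
    show "(\<integral>\<^sup>+z. ennreal (indicator ?D (s, z) * exp (- (c * fst (s, z)))) \<partial>lborel) = ennreal ?I * ennreal (erlang_density ?n c s)"
    proof (cases "0 < s")
      case False
      then have "erlang_density ?n c s = 0" by (auto simp: erlang_density_def zero_power)
      then show ?thesis using False by simp
    next
      case True
      have A: "{z. (1 / (r * s)) *\<^sub>R z \<in> K} \<in> sets borel"
      proof -
        have "(\<lambda>z :: real^'n. (1 / (r * s)) *\<^sub>R z) \<in> borel_measurable borel" by measurable
        from measurable_sets[OF this Kb] show ?thesis by (simp add: vimage_def)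
      qed
      have "(\<integral>\<^sup>+z. ennreal (indicator ?D (s, z) * exp (- (c * fst (s, z)))) \<partial>lborel)
          = (\<integral>\<^sup>+z. ennreal (exp (- (c * s))) * indicator {z. (1 / (r * s)) *\<^sub>R z \<in> K} z \<partial>lborel)"
        using True by (intro nn_integral_cong) (auto simp: indicator_def)
      also have "\<dots> = ennreal (exp (- (c * s))) * ennreal ((r * s) ^ ?n * measure lebesgue K)"
        using A True r by (simp add: nn_integral_cmult_indicator emeasure_scaled[OF K])
      also have "\<dots> = ennreal (exp (- (c * s)) * ((r * s) ^ ?n * measure lebesgue K))"
        by (rule ennreal_mult'[symmetric]) simp
      also have "exp (- (c * s)) * ((r * s) ^ ?n * measure lebesgue K) = ?I * erlang_density ?n c s"
        using True c by (simp add: erlang_density_def power_mult_distrib field_simps)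
      also have "ennreal (?I * erlang_density ?n c s) = ennreal ?I * ennreal (erlang_density ?n c s)"
        using r c by (intro ennreal_mult) auto
      finally show ?thesis .
    qed
  qed
  also have "\<dots> = ennreal ?I"
  proof -
    have "(\<integral>\<^sup>+s. ennreal (erlang_density ?n c s) \<partial>lborel) = 1"
      using prob_space.emeasure_space_1[OF prob_space_erlang_density[OF c, of ?n]]
      by (simp add: emeasure_density)
    then show ?thesis by (simp add: nn_integral_cmult)
  qed
  finally have "(?F has_integral ?I) UNIV"
    using r c by (intro nn_integral_has_integral F_b) auto
  then show ?thesis by (simp only: has_integral_restrict_UNIV)
qed

section \<open>Supports of measures and the lifted frame\<close>

lemma compact_supp:
  fixes Z :: "'a::metric_space measure"
  assumes "compact (space Z)"
  shows "compact (supp Z)"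
proof -
  have "openin (top_of_set (space Z)) (space Z - supp Z)"
  proof (subst openin_subopen, intro ballI)
    fix u assume "u \<in> space Z - supp Z"
    then obtain U where U: "openin (top_of_set (space Z)) U" "u \<in> U" "emeasure Z U = 0"
      by (auto simp: supp_def not_gr_zero)
    moreover have "U \<subseteq> space Z - supp Z"
      using U openin_imp_subset[OF U(1)] by (auto simp: supp_def)
    ultimately show "\<exists>T. openin (top_of_set (space Z)) T \<and> u \<in> T \<and> T \<subseteq> space Z - supp Z"
      by blast
  qed
  moreover have "supp Z \<subseteq> space Z" by (auto simp: supp_def)
  ultimately have "closedin (top_of_set (space Z)) (supp Z)"
    by (simp add: closedin_def)
  then show ?thesis using assms closedin_compact by blast
qed

text \<open>The complement of the support is a union of open null sets; by the Lindeloef property countably many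
  of them suffice.\<close>

lemma AE_in_supp:
  fixes Z :: "'a::second_countable_topology measure"
  assumes sets: "\<And>U. openin (top_of_set (space Z)) U \<Longrightarrow> U \<in> sets Z"
  shows "AE u in Z. u \<in> supp Z"
proof -
  let ?F = "{U. openin (top_of_set (space Z)) U \<and> emeasure Z U = 0}"
  obtain F where F: "F \<subseteq> ?F" "countable F" "\<Union>F = \<Union>?F"
    using Lindelof_openin[of ?F "space Z"] by blast
  have "\<Union>F \<in> null_sets Z"
  proof -
    have "(\<Union>U\<in>F. U) \<in> null_sets Z"
      using F(1,2) sets by (intro null_sets_UN') (auto simp: null_sets_def)
    then show ?thesis by simp
  qed
  moreover have "{u \<in> space Z. u \<notin> supp Z} \<subseteq> \<Union>F"
    unfolding F(3) by (auto simp: supp_def not_gr_zero)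
  ultimately show ?thesis by (auto intro: AE_I')
qed

text \<open>Continuous identities that hold almost everywhere hold on the whole support, since the set where they
  fail is open and null.\<close>

lemma supp_AE_eq_imp_eq:
  fixes f g :: "'a::topological_space \<Rightarrow> 'b::real_normed_vector"
  assumes ae: "AE u in Z. f u = g u"
    and cont: "continuous_on (space Z) f" "continuous_on (space Z) g"
    and u: "u \<in> supp Z"
  shows "f u = g u"
proof (rule ccontr)
  assume neq: "f u \<noteq> g u"
  let ?U = "{u \<in> space Z. f u \<noteq> g u}"
  have "closedin (top_of_set (space Z)) {u \<in> space Z. f u - g u = 0}"
    by (intro continuous_closedin_preimage_constant continuous_on_diff cont)
  then have "openin (top_of_set (space Z)) (space Z - {u \<in> space Z. f u - g u = 0})"
    by (simp add: openin_diff)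
  moreover have "space Z - {u \<in> space Z. f u - g u = 0} = ?U" by auto
  ultimately have "openin (top_of_set (space Z)) ?U" by simp
  moreover have "u \<in> ?U" using u neq by (simp add: supp_def)
  ultimately have "0 < emeasure Z ?U" using u by (simp add: supp_def)
  moreover have "emeasure Z ?U = 0"
  proof -
    obtain N where N: "{u \<in> space Z. \<not> f u = g u} \<subseteq> N" "emeasure Z N = 0" "N \<in> sets Z"
      using AE_E[OF ae] by blast
    then have "emeasure Z ?U \<le> emeasure Z N" by (intro emeasure_mono) auto
    then show ?thesis using N(2) by simp
  qed
  ultimately show False by simp
qed

text \<open>The scaling makes unit vectors of unit vectors, and turns inner product \<open>- 1 / n\<close>, the one between
  vertices of a regular inscribed simplex, into orthogonality.\<close>

definition lift :: "real^'n \<Rightarrow> real^'n::finite homog" where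
  "lift u = homog (1 / sqrt (real CARD('n) + 1), sqrt (real CARD('n) / (real CARD('n) + 1)) *\<^sub>R u)"

text \<open>The linear form that is 1 on every lifted vector.\<close>

definition height_form :: "real^'n::finite homog" where
  "height_form = homog (sqrt (real CARD('n) + 1), 0)"

lemma inner_lift: "lift u \<bullet> lift u' = (1 + real CARD('n) * (u \<bullet> u')) / (real CARD('n) + 1)"
  for u :: "real^'n"
  by (simp add: lift_def inner_homog mult.assoc[symmetric] add_divide_distrib)

lemma height_form_lift: "height_form \<bullet> lift u = 1"
  by (simp add: lift_def height_form_def inner_homog)

lemma norm_lift: "norm u = 1 \<Longrightarrow> norm (lift u) = 1" for u :: "real^'n"
  using inner_lift[of u u] by (simp add: norm_eq_1 add.commute)

lemma continuous_on_lift: "continuous_on S lift"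
  unfolding lift_def
  by (intro continuous_on_compose2[OF linear_continuous_on[OF linear_homog[unfolded linear_conv_bounded_linear], of UNIV]]
      continuous_intros) auto

lemma norm_eq_1_inner_less:
  assumes "norm u = 1" "norm u' = 1" "u \<noteq> u'"
  shows "u \<bullet> u' < 1"
proof -
  have "0 < (u - u') \<bullet> (u - u')" using assms(3) by simp
  also have "\<dots> = 2 - 2 * (u \<bullet> u')"
    using assms by (simp add: inner_diff_left inner_diff_right norm_eq_1 inner_commute[of u' u])
  finally show ?thesis by simp
qed

text \<open>The volume of a regular simplex inscribed in the unit sphere of \<open>\<real>\<^sup>n\<close>.\<close>

definition simplex_volume :: "nat \<Rightarrow> real" where
  "simplex_volume n = (real n + 1) powr ((real n + 1) / 2) * real n powr (- (real n / 2)) / fact n"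

lemma simplex_volume_pos: "0 < n \<Longrightarrow> 0 < simplex_volume n"
  by (simp add: simplex_volume_def)

lemma simplex_volume_eq:
  assumes "0 < n"
  shows "sqrt (real n) ^ n * fact n / sqrt (real n + 1) ^ (n + 1) = 1 / simplex_volume n"
proof -
  have half: "sqrt x ^ k = x powr (real k / 2)" if "0 < x" for x k
    using that by (simp add: powr_half_sqrt[symmetric] powr_power)
  have "sqrt (real n) ^ n = real n powr (real n / 2)" using assms by (intro half) simp
  moreover have "sqrt (real n + 1) ^ (n + 1) = (real n + 1) powr ((real n + 1) / 2)"
    by (subst half) (auto simp: add.commute)
  ultimately show ?thesis
    using assms by (simp add: simplex_volume_def powr_minus divide_simps)
qed

locale balanced_isotropic =
  fixes Z :: "(real^'n) measure"
  assumes finite_sphere_measure: "finite_sphere_measure Z"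
    and isotropic: "isotropic Z"
    and balanced: "centroid Z = 0"
begin

lemma sets_Z: "sets Z = sets (restrict_space borel (sphere 0 1))"
  using finite_sphere_measure by (simp add: finite_sphere_measure_def)

lemma space_Z: "space Z = sphere 0 1"
  using sets_eq_imp_space_eq[OF sets_Z] by (simp add: space_restrict_space)

lemma openin_sets_Z: "openin (top_of_set (space Z)) U \<Longrightarrow> U \<in> sets Z"
  by (auto simp: openin_open sets_Z space_Z sets_restrict_space)

lemma borel_measurable_Z: "f \<in> borel_measurable borel \<Longrightarrow> f \<in> borel_measurable Z"
  using measurable_restrict_space1 measurable_cong_sets[OF sets_Z refl] by blast

sublocale sphere: isotropic_frame Z "\<lambda>u. u"
proof -
  interpret finite_measure Z
    using finite_sphere_measure by (simp add: finite_sphere_measure_def)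
  show "isotropic_frame Z (\<lambda>u. u)"
  proof
    show "(\<lambda>u. u) \<in> borel_measurable Z" by (rule borel_measurable_Z) simp
    show "norm u = 1" if "u \<in> space Z" for u using that by (simp add: space_Z)
    show "(LINT u|Z. (x \<bullet> u)\<^sup>2) = (norm x)\<^sup>2" for x
      using isotropic by (simp add: isotropic_def)
  qed
qed

lemma integrable_Z: "integrable Z (\<lambda>u. u)"
  by (rule sphere.integrable_bounded[where B = 1]) (auto simp: space_Z)

lemma integral_Z_zero: "(LINT u|Z. u) = 0"
  using balanced by (simp add: centroid_def sphere.total_mass)

definition lifted :: "(real^'n) measure" where
  "lifted = density Z (\<lambda>_. ennreal ((real CARD('n) + 1) / real CARD('n)))"

lemma space_lifted: "space lifted = sphere 0 1"
  by (simp add: lifted_def space_Z)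

lemma AE_lifted: "(AE u in lifted. P u) \<longleftrightarrow> (AE u in Z. P u)"
  unfolding lifted_def by (subst AE_density) (auto simp: divide_pos_pos add_pos_pos)

text \<open>Expanding \<open>(x \<bullet> lift u)\<^sup>2\<close> for \<open>x = (s, z)\<close> gives a constant, a term linear in \<open>u\<close> and a quadratic one.
  Their integrals are controlled by the total mass, by the centroid and by isotropy of \<open>Z\<close>, respectively.\<close>

sublocale lift: transport_frame lifted lift
proof -
  have meas: "lift \<in> borel_measurable Z"
    by (intro borel_measurable_Z borel_measurable_continuous_onI continuous_on_lift)
  have "finite_measure lifted"
  proof
    have "emeasure lifted (space lifted) = ennreal ((real CARD('n) + 1) / real CARD('n)) * emeasure Z (space Z)"
      unfolding lifted_def by (simp add: emeasure_density_const)
    also have "\<dots> \<noteq> \<infinity>"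
      using sphere.emeasure_finite[of "space Z"] by (simp add: ennreal_mult_eq_top_iff)
    finally show "emeasure lifted (space lifted) \<noteq> \<infinity>" .
  qed
  then interpret finite_measure lifted .
  show "transport_frame lifted lift"
  proof
    show "lift \<in> borel_measurable lifted"
      using meas by (simp add: lifted_def)
    show "norm (lift u) = 1" if "u \<in> space lifted" for u
      using that by (intro norm_lift) (simp add: space_lifted)
    show "(LINT u|lifted. (x \<bullet> lift u)\<^sup>2) = (norm x)\<^sup>2" for x
    proof -
      obtain s z where x: "x = homog (s, z)"
        using bij_homog by (metis bij_pointE surj_pair)
      have "(LINT u|lifted. (x \<bullet> lift u)\<^sup>2) = (LINT u|Z. ((real CARD('n) + 1) / real CARD('n)) * (x \<bullet> lift u)\<^sup>2)"
        unfolding lifted_def by (subst integral_density) (use meas in auto)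
      also have "\<dots> = (LINT u|Z. s\<^sup>2 / real CARD('n) + (2 * s / sqrt (real CARD('n))) * (z \<bullet> u) + (z \<bullet> u)\<^sup>2)"
      proof (intro Bochner_Integration.integral_cong refl)
        fix u
        define q where "q = sqrt (real CARD('n))"
        define p where "p = sqrt (real CARD('n) + 1)"
        have pq: "0 < p" "0 < q" "real CARD('n) + 1 = p\<^sup>2" "real CARD('n) = q\<^sup>2"
          by (auto simp: p_def q_def)
        have "x \<bullet> lift u = s / p + q / p * (z \<bullet> u)"
          by (simp add: x lift_def inner_homog real_sqrt_divide p_def q_def)
        also have "\<dots> = (s + q * (z \<bullet> u)) / p" by (simp add: add_divide_distrib)
        finally have "((real CARD('n) + 1) / real CARD('n)) * (x \<bullet> lift u)\<^sup>2 = (s + q * (z \<bullet> u))\<^sup>2 / q\<^sup>2"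
          using pq(1,2) unfolding pq(3) unfolding pq(4) by (simp add: power_divide)
        also have "\<dots> = (s\<^sup>2 + 2 * s * q * (z \<bullet> u) + q\<^sup>2 * (z \<bullet> u)\<^sup>2) / q\<^sup>2"
          by (simp add: power2_eq_square algebra_simps)
        also have "\<dots> = s\<^sup>2 / q\<^sup>2 + (2 * s / q) * (z \<bullet> u) + (z \<bullet> u)\<^sup>2"
          using pq(2) by (simp add: add_divide_distrib power2_eq_square)
        finally show "((real CARD('n) + 1) / real CARD('n)) * (x \<bullet> lift u)\<^sup>2 = s\<^sup>2 / real CARD('n) + (2 * s / sqrt (real CARD('n))) * (z \<bullet> u) + (z \<bullet> u)\<^sup>2"
          by (simp add: q_def)
      qed
      also have "\<dots> = s\<^sup>2 / real CARD('n) * real CARD('n) + (2 * s / sqrt (real CARD('n))) * (z \<bullet> (LINT u|Z. u)) + (norm z)\<^sup>2"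
        using integrable_Z sphere.integrable_inner_v_sq[of z]
        by (simp add: Bochner_Integration.integral_add sphere.isotropic_v sphere.total_mass)
      also have "\<dots> = (norm x)\<^sup>2"
        unfolding x power2_norm_eq_inner inner_homog by (simp add: integral_Z_zero power2_eq_square)
      finally show ?thesis .
    qed
  qed
qed

lemma supp_subset: "supp Z \<subseteq> sphere 0 1"
  by (auto simp: supp_def space_Z)

lemma norm_supp: "u \<in> supp Z \<Longrightarrow> norm u = 1"
  using supp_subset by auto

lemma AE_lifted_supp: "AE u in lifted. u \<in> supp Z"
  unfolding AE_lifted by (rule AE_in_supp[OF openin_sets_Z])

lemma compact_Z_infty: "compact (Z_infty Z)"
  unfolding Z_infty_def by (intro compact_convex_hull compact_supp) (simp add: space_Z)

abbreviation cone :: "(real^'n homog) set" where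
  "cone \<equiv> cone_over (sqrt (real CARD('n))) (Z_infty Z)"

text \<open>The base point of \<open>transport y\<close>, divided by \<open>sqrt n\<close> times its height, is the mean of \<open>u\<close> with the
  positive weights \<open>T (y \<bullet> lift u)\<close>. Such a mean cannot be separated from the closed convex set \<open>Z_infty Z\<close>
  by a hyperplane, because almost every \<open>u\<close> lies in that set.\<close>

lemma transport_in_cone: "lift.transport y \<in> cone"
proof -
  let ?T = "\<lambda>u. gauss_exp_map (y \<bullet> lift u)"
  have cont: "continuous_on UNIV gauss_exp_map" by (rule continuous_on_gauss_exp_map)
  obtain s z where sz: "lift.transport y = homog (s, z)"
    using bij_homog by (metis bij_pointE surj_pair)
  define t where "t = (LINT u|lifted. ?T u)"
  have int: "integrable lifted ?T" by (rule lift.integrable_continuous_inner_v(1)[OF cont])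
  have "0 < t"
  proof -
    obtain p where p: "\<And>u. u \<in> space lifted \<Longrightarrow> gauss_exp_map p \<le> ?T u"
      using lift.continuous_inner_v_bounds[OF cont] by blast
    have "0 < gauss_exp_map p * measure lifted (space lifted)"
      by (simp add: lift.total_mass gauss_exp_map_pos)
    also have "\<dots> = (LINT u|lifted. gauss_exp_map p)" by simp
    also have "\<dots> \<le> t" unfolding t_def by (intro integral_mono int p) auto
    finally show ?thesis .
  qed
  have "s = homog (1, 0) \<bullet> lift.transport y"
    by (simp add: sz inner_homog)
  also have "\<dots> = t / sqrt (real CARD('n) + 1)"
    by (simp add: lift.inner_transport lift_def inner_homog t_def)
  finally have s: "s = t / sqrt (real CARD('n) + 1)" .
  then have "0 < s" using \<open>0 < t\<close> by simp
  moreover have "(1 / (sqrt (real CARD('n)) * s)) *\<^sub>R z \<in> Z_infty Z"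
  proof (rule ccontr)
    assume notin: "(1 / (sqrt (real CARD('n)) * s)) *\<^sub>R z \<notin> Z_infty Z"
    have "convex (Z_infty Z)" "closed (Z_infty Z)"
      using compact_Z_infty by (auto simp: Z_infty_def compact_imp_closed)
    from separating_hyperplane_closed_point[OF this notin]
    obtain a b where ab: "a \<bullet> ((1 / (sqrt (real CARD('n)) * s)) *\<^sub>R z) < b" "\<And>k. k \<in> Z_infty Z \<Longrightarrow> b < a \<bullet> k"
      by blast
    have "a \<bullet> z = homog (0, a) \<bullet> lift.transport y"
      by (simp add: sz inner_homog)
    also have "\<dots> = (LINT u|lifted. ?T u * (homog (0, a) \<bullet> lift u))"
      by (rule lift.inner_transport)
    also have "\<dots> \<ge> (LINT u|lifted. sqrt (real CARD('n) / (real CARD('n) + 1)) * b * ?T u)"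
    proof (rule integral_mono_AE)
      show "integrable lifted (\<lambda>u. sqrt (real CARD('n) / (real CARD('n) + 1)) * b * ?T u)" using int by simp
      show "integrable lifted (\<lambda>u. ?T u * (homog (0, a) \<bullet> lift u))"
        using integrable_inner_right[OF lift.integrable_continuous_inner_v(2)[OF cont, of y], of "homog (0, a)"]
        by simp
      show "AE u in lifted. sqrt (real CARD('n) / (real CARD('n) + 1)) * b * ?T u \<le> ?T u * (homog (0, a) \<bullet> lift u)"
        using AE_lifted_supp
      proof (rule eventually_mono)
        fix u assume "u \<in> supp Z"
        then have "b \<le> a \<bullet> u"
          using ab(2)[of u] by (auto simp: Z_infty_def hull_inc intro: less_imp_le)
        then have "?T u * (sqrt (real CARD('n) / (real CARD('n) + 1)) * b) \<le> ?T u * (sqrt (real CARD('n) / (real CARD('n) + 1)) * (a \<bullet> u))"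
          using gauss_exp_map_pos by (intro mult_left_mono) (auto intro: less_imp_le)
        then show "sqrt (real CARD('n) / (real CARD('n) + 1)) * b * ?T u \<le> ?T u * (homog (0, a) \<bullet> lift u)"
          by (simp add: lift_def inner_homog mult_ac)
      qed
    qed
    also have "(LINT u|lifted. sqrt (real CARD('n) / (real CARD('n) + 1)) * b * ?T u) = sqrt (real CARD('n)) * s * b"
      by (simp add: t_def[symmetric] s real_sqrt_divide)
    finally have "sqrt (real CARD('n)) * s * b \<le> a \<bullet> z" .
    moreover have "a \<bullet> z < sqrt (real CARD('n)) * s * b"
    proof -
      have pos: "0 < sqrt (real CARD('n)) * s" using \<open>0 < s\<close> by simp
      have "a \<bullet> z / (sqrt (real CARD('n)) * s) < b" using ab(1) by simp
      then show ?thesis using pos by (simp only: pos_divide_less_eq) (simp add: mult_ac)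
    qed
    ultimately show False by simp
  qed
  ultimately show ?thesis
    unfolding sz by (simp add: homog_in_cone_over_iff)
qed

lemma has_integral_cone:
  "((\<lambda>x. exp (- (height_form \<bullet> x))) has_integral measure lebesgue (Z_infty Z) / simplex_volume CARD('n)) cone"
proof -
  have "measure lebesgue (Z_infty Z) *
      (sqrt (real CARD('n)) ^ CARD('n) * fact CARD('n) / sqrt (real CARD('n) + 1) ^ (CARD('n) + 1))
      = measure lebesgue (Z_infty Z) / simplex_volume CARD('n)"
    by (subst simplex_volume_eq) auto
  moreover have "0 < sqrt (real CARD('n))" "0 < sqrt (real CARD('n) + 1)" by auto
  ultimately show ?thesis
    using has_integral_cone_over[OF compact_Z_infty, of "sqrt (real CARD('n))" "sqrt (real CARD('n) + 1)"]
    unfolding height_form_def by (simp only:)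
qed

section \<open>The volume inequality and its equality case\<close>

text \<open>The chain of inequalities behind the theorem: the Gaussian integral 1, the integral over the image of
  the transport map, and the integral over the whole cone.\<close>

lemma has_integral_range_transport_le:
  obtains b where "((\<lambda>x. exp (- (height_form \<bullet> x))) has_integral b) (range lift.transport)"
    "1 \<le> b" "b \<le> measure lebesgue (Z_infty Z) / simplex_volume CARD('n)"
proof -
  let ?F = "\<lambda>x :: real^'n homog. exp (- (height_form \<bullet> x))"
  have sub: "range lift.transport \<subseteq> cone"
    using transport_in_cone by blast
  have "?F absolutely_integrable_on cone"
    by (rule absolutely_integrable_on_iff_nonneg[THEN iffD2, OF _ has_integral_integrable[OF has_integral_cone]]) simp
  then have "?F absolutely_integrable_on (range lift.transport)"
    by (rule set_integrable_subset[OF _ _ sub])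
      (simp add: borel_open lift.open_range_transport sets_completionI_sets)
  then obtain b where b: "(?F has_integral b) (range lift.transport)"
    using set_lebesgue_integral_eq_integral(1) by blast
  show ?thesis
  proof (rule that[OF b])
    show "1 \<le> b"
      by (rule lift.transport_integral_ge_1[OF height_form_lift b])
    show "b \<le> measure lebesgue (Z_infty Z) / simplex_volume CARD('n)"
      by (rule has_integral_subset_le[OF sub b has_integral_cone]) simp
  qed
qed

lemma volume_ge: "simplex_volume CARD('n) \<le> measure lebesgue (Z_infty Z)"
proof -
  have "1 \<le> measure lebesgue (Z_infty Z) / simplex_volume CARD('n)"
    using has_integral_range_transport_le by (metis order_trans)
  then show ?thesis using simplex_volume_pos[of "CARD('n)"] by (simp add: pos_le_divide_eq)
qed

lemma inner_lift_eq_1_iff: "u \<in> supp Z \<Longrightarrow> u' \<in> supp Z \<Longrightarrow> lift u \<bullet> lift u' = 1 \<longleftrightarrow> u = u'"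
proof -
  assume "u \<in> supp Z" "u' \<in> supp Z"
  then have "u \<bullet> u' = 1 \<longleftrightarrow> u = u'"
    using norm_eq_1_inner_less[of u u'] norm_supp[of u] norm_supp[of u']
    by (cases "u = u'") (simp_all add: dot_square_norm)
  moreover have "lift u \<bullet> lift u' = 1 \<longleftrightarrow> 1 + real CARD('n) * (u \<bullet> u') = real CARD('n) + 1"
    unfolding inner_lift by (subst divide_eq_1_iff) auto
  ultimately show ?thesis by simp
qed

text \<open>If the volumes agree, both inequalities in the chain are equalities, so for almost every \<open>y\<close> all lifted
  support vectors are eigenvectors of the derivative of the transport map, with eigenvalues
  \<open>T' (y \<bullet> lift u)\<close>. The set of \<open>y\<close> at which the eigenvalues of two given points differ is open and
  nonempty, so one such \<open>y\<close> is generic; there the two vectors are orthogonal by self-adjointness.\<close>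

lemma eq_imp_lift_orthogonal:
  assumes eq: "measure lebesgue (Z_infty Z) = simplex_volume CARD('n)"
    and u: "u \<in> supp Z" "u' \<in> supp Z" "u \<noteq> u'"
  shows "lift u \<bullet> lift u' = 0"
proof -
  obtain b where b: "((\<lambda>x. exp (- (height_form \<bullet> x))) has_integral b) (range lift.transport)"
    "1 \<le> b" "b \<le> measure lebesgue (Z_infty Z) / simplex_volume CARD('n)"
    by (rule has_integral_range_transport_le)
  have "b = 1" using b(2,3) simplex_volume_pos[of "CARD('n)"] by (simp add: eq)
  let ?A = "lift.transport_deriv" and ?t = "\<lambda>y u. gauss_exp_deriv (y \<bullet> lift u)"
  have linear: "linear (?A y)" for y
    using lift.transport_has_derivative[of y] has_derivative_linear by blast
  have ae: "AE y in lebesgue. \<forall>u\<in>supp Z. ?A y (lift u) = ?t y u *\<^sub>R lift u"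
    using lift.transport_integral_eq_1_imp[OF height_form_lift b(1)[unfolded \<open>b = 1\<close>]]
  proof (rule eventually_mono, intro ballI)
    fix y u assume "AE u in lifted. ?A y (lift u) = ?t y u *\<^sub>R lift u" "u \<in> supp Z"
    then show "?A y (lift u) = ?t y u *\<^sub>R lift u"
    proof (intro supp_AE_eq_imp_eq[where Z = Z])
      show "continuous_on (space Z) (\<lambda>u. ?A y (lift u))"
        using linear_continuous_on[of "?A y" UNIV] linear[of y]
        by (intro continuous_on_compose2[of UNIV "?A y" _ lift] continuous_on_lift)
          (auto simp: linear_conv_bounded_linear)
      show "continuous_on (space Z) (\<lambda>u. ?t y u *\<^sub>R lift u)"
        by (intro continuous_intros continuous_on_compose2[OF continuous_on_gauss_exp_deriv[of UNIV]]
            continuous_on_lift) auto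
    qed (simp_all add: AE_lifted)
  qed
  let ?c = "lift u \<bullet> lift u'"
  have uu: "lift u \<bullet> lift u = 1" "lift u' \<bullet> lift u' = 1"
    using inner_lift_eq_1_iff u by auto
  have c: "?c \<noteq> 1" "?c \<noteq> -1"
  proof -
    show "?c \<noteq> 1" using inner_lift_eq_1_iff u by auto
    show "?c \<noteq> -1"
    proof
      \<comment> \<open>antipodal lifts are impossible because both satisfy \<open>height_form \<bullet> x = 1\<close>\<close>
      assume "?c = -1"
      then have "(lift u + lift u') \<bullet> (lift u + lift u') = 0"
        using uu by (simp add: inner_add_left inner_add_right inner_commute[of "lift u'" "lift u"])
      then have "lift u + lift u' = 0" by simp
      moreover have "height_form \<bullet> (lift u + lift u') = 2"
        by (simp add: inner_add_right height_form_lift)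
      ultimately show False by simp
    qed
  qed
  obtain p q where pq: "gauss_exp_deriv p \<noteq> gauss_exp_deriv q"
    by (rule gauss_exp_deriv_nonconstant)
  let ?W = "{y. ?t y u \<noteq> ?t y u'}"
  have "open ?W"
    by (intro open_Collect_neq continuous_on_compose2[OF continuous_on_gauss_exp_deriv[of UNIV]] continuous_intros) auto
  moreover have "?W \<noteq> {}"
  proof -
    define d where "d = 1 - ?c\<^sup>2"
    have "d \<noteq> 0" using c by (auto simp: d_def power2_eq_1_iff)
    \<comment> \<open>the solution of \<open>y \<bullet> lift u = p\<close>, \<open>y \<bullet> lift u' = q\<close>; \<open>d\<close> is the Gram determinant of the two lifts\<close>
    define y where "y = ((p - q * ?c) / d) *\<^sub>R lift u + ((q - p * ?c) / d) *\<^sub>R lift u'"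
    have "y \<bullet> lift u = ((p - q * ?c) + (q - p * ?c) * ?c) / d"
      by (simp add: y_def inner_add_left uu inner_commute[of "lift u'" "lift u"] add_divide_distrib)
    also have "(p - q * ?c) + (q - p * ?c) * ?c = p * d"
      by (simp add: d_def algebra_simps power2_eq_square)
    finally have 1: "y \<bullet> lift u = p" using \<open>d \<noteq> 0\<close> by simp
    have "y \<bullet> lift u' = ((p - q * ?c) * ?c + (q - p * ?c)) / d"
      by (simp add: y_def inner_add_left uu add_divide_distrib)
    also have "(p - q * ?c) * ?c + (q - p * ?c) = q * d"
      by (simp add: d_def algebra_simps power2_eq_square)
    finally have 2: "y \<bullet> lift u' = q" using \<open>d \<noteq> 0\<close> by simp
    show ?thesis using 1 2 pq by auto
  qed
  ultimately have "\<not> negligible ?W" using open_not_negligible by blast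
  have "\<exists>y\<in>?W. \<forall>u\<in>supp Z. ?A y (lift u) = ?t y u *\<^sub>R lift u"
  proof (rule ccontr)
    assume "\<not> ?thesis"
    then have "AE y in lebesgue. y \<notin> ?W"
      using ae by (auto elim!: eventually_mono)
    then have "negligible ?W"
      by (auto simp: negligible_iff_null_sets AE_iff_null_sets completion.AE_iff_null_sets eventually_ae_filter
          intro: null_sets_completion_subset)
    then show False using \<open>\<not> negligible ?W\<close> by blast
  qed
  then obtain y where y: "?t y u \<noteq> ?t y u'" "?A y (lift u) = ?t y u *\<^sub>R lift u" "?A y (lift u') = ?t y u' *\<^sub>R lift u'"
    using u by auto
  obtain B where B: "\<And>a. a \<in> space lifted \<Longrightarrow> \<bar>?t y a\<bar> \<le> B"
    using lift.continuous_inner_v_bounded[OF continuous_on_gauss_exp_deriv] by blast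
  have "?A y (lift u) \<bullet> lift u' = lift u \<bullet> ?A y (lift u')"
    by (rule lift.frame_op_self_adjoint[OF lift.continuous_inner_v_measurable[OF continuous_on_gauss_exp_deriv] B])
  then show ?thesis using y by simp
qed

lemma lift_orthogonal_iff: "lift u \<bullet> lift u' = 0 \<longleftrightarrow> u \<bullet> u' = - 1 / real CARD('n)"
  for u u' :: "real^'n"
  by (auto simp: inner_lift field_simps add_eq_0_iff)

text \<open>The lifted support is orthonormal, and it spans because a vector orthogonal to almost all of the frame
  vanishes. Hence the support has \<open>n + 1\<close> points with all mutual inner products \<open>- 1 / n\<close>, and such
  points are affinely independent and equidistant.\<close>

lemma eq_imp_regular_simplex:
  assumes eq: "measure lebesgue (Z_infty Z) = simplex_volume CARD('n)"
  shows "regular_simplex (Z_infty Z)" "inscribed_in_sphere (Z_infty Z)"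
proof -
  note orth = eq_imp_lift_orthogonal[OF eq]
  have vert: "vertices (Z_infty Z) \<subseteq> supp Z"
    unfolding vertices_def Z_infty_def using extreme_point_of_convex_hull by blast
  show "inscribed_in_sphere (Z_infty Z)"
    unfolding inscribed_in_sphere_def using vert supp_subset by blast
  have inj: "inj_on lift (supp Z)"
    using inner_lift_eq_1_iff by (intro inj_onI) metis
  have basis: "pairwise orthogonal (lift ` supp Z)" "\<And>b. b \<in> lift ` supp Z \<Longrightarrow> norm b = 1"
    using orth norm_lift norm_supp by (auto simp: pairwise_def orthogonal_def)
  have span: "span (lift ` supp Z) = UNIV"
  proof (rule ccontr)
    assume "span (lift ` supp Z) \<noteq> UNIV"
    then have "span (lift ` supp Z) \<subset> span UNIV" by auto
    then obtain x where x: "x \<noteq> 0" "\<And>y. y \<in> span (lift ` supp Z) \<Longrightarrow> orthogonal x y"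
      using orthogonal_to_subspace_exists_gen by blast
    have "AE u in lifted. x \<bullet> lift u = 0"
      using AE_lifted_supp x(2) by (auto elim!: eventually_mono simp: orthogonal_def span_base)
    then show False using lift.AE_inner_zero_imp x(1) by blast
  qed
  have card: "card (supp Z) = CARD('n) + 1"
    using orthonormal_basis_card[OF basis span] card_image[OF inj] by (simp add: card_homog)
  have fin: "finite (supp Z)"
    using card by (simp add: card_ge_0_finite)
  have inner: "u \<bullet> u' = (if u = u' then 1 else - 1 / real CARD('n))" if "u \<in> supp Z" "u' \<in> supp Z" for u u'
    using that orth[of u u'] lift_orthogonal_iff[of u u'] norm_supp[of u] by (auto simp: dot_square_norm)
  have "\<not> affine_dependent (supp Z)"
  proof
    assume "affine_dependent (supp Z)"
    then obtain c w where c: "sum c (supp Z) = 0" "w \<in> supp Z" "c w \<noteq> 0" "(\<Sum>u\<in>supp Z. c u *\<^sub>R u) = 0"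
      using affine_dependent_explicit_finite[OF fin] by blast
    have "0 = (\<Sum>u\<in>supp Z. c u *\<^sub>R u) \<bullet> w" by (simp add: c(4))
    also have "\<dots> = (\<Sum>u\<in>supp Z. (if u = w then c u * (1 + 1 / real CARD('n)) else 0) - c u * (1 / real CARD('n)))"
      unfolding inner_sum_left
    proof (rule sum.cong[OF refl])
      fix u assume "u \<in> supp Z"
      then show "(c u *\<^sub>R u) \<bullet> w = (if u = w then c u * (1 + 1 / real CARD('n)) else 0) - c u * (1 / real CARD('n))"
        by (simp add: inner[OF _ c(2)] algebra_simps)
    qed
    also have "\<dots> = c w * (1 + 1 / real CARD('n)) - (\<Sum>u\<in>supp Z. c u * (1 / real CARD('n)))"
      unfolding sum_subtractf using fin c(2) by simp
    also have "(\<Sum>u\<in>supp Z. c u * (1 / real CARD('n))) = 0"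
      unfolding sum_distrib_right[symmetric] c(1) by simp
    finally have "c w * (1 + 1 / real CARD('n)) = 0" by simp
    moreover have "0 < 1 + 1 / real CARD('n)" by (intro add_pos_nonneg) auto
    ultimately show False using c(3) by simp
  qed
  then have "int CARD('n) simplex Z_infty Z"
    unfolding simplex Z_infty_def using card fin by (intro exI[of _ "supp Z"]) simp
  moreover have "dist v w = sqrt (2 + 2 / real CARD('n))"
    if "v \<in> vertices (Z_infty Z)" "w \<in> vertices (Z_infty Z)" "v \<noteq> w" for v w
  proof -
    have vw: "v \<in> supp Z" "w \<in> supp Z" using that vert by auto
    have "(dist v w)\<^sup>2 = v \<bullet> v + w \<bullet> w - 2 * (v \<bullet> w)"
      by (simp add: dist_norm power2_norm_eq_inner inner_diff_left inner_diff_right inner_commute[of w v])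
    also have "\<dots> = 2 + 2 / real CARD('n)"
      using inner[of v v] inner[of w w] inner[of v w] vw that(3) by simp
    finally show ?thesis by (metis real_sqrt_unique zero_le_dist)
  qed
  ultimately show "regular_simplex (Z_infty Z)"
    unfolding regular_simplex_def by blast
qed

text \<open>The vertices are extreme points of the convex hull of the support and so belong to the support. A unit
  vector different from all vertices is separated from them by the tangent hyperplane
  at that vector, so it lies outside the simplex.\<close>

lemma simplex_imp_supp:
  assumes simplex: "int CARD('n) simplex Z_infty Z" and inscribed: "inscribed_in_sphere (Z_infty Z)"
  shows "finite (supp Z)" "card (supp Z) = CARD('n) + 1"
proof -
  obtain C where C: "\<not> affine_dependent C" "int (card C) = int CARD('n) + 1" "Z_infty Z = convex hull C"
    using simplex unfolding simplex_def by blast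
  have vert: "vertices (Z_infty Z) = C"
    unfolding vertices_def C(3) using extreme_point_of_convex_hull_affine_independent[OF C(1)] by auto
  have "C \<subseteq> supp Z"
    unfolding vert[symmetric] vertices_def Z_infty_def using extreme_point_of_convex_hull by blast
  moreover have "supp Z \<subseteq> C"
  proof
    fix u assume u: "u \<in> supp Z"
    show "u \<in> C"
    proof (rule ccontr)
      assume "u \<notin> C"
      have "C \<subseteq> {x. u \<bullet> x < 1}"
      proof
        fix x assume x: "x \<in> C"
        then have "norm x = 1" using inscribed vert by (auto simp: inscribed_in_sphere_def)
        moreover have "u \<noteq> x" using \<open>u \<notin> C\<close> x by blast
        ultimately show "x \<in> {x. u \<bullet> x < 1}"
          using norm_eq_1_inner_less[OF norm_supp[OF u]] by simp
      qed
      then have "convex hull C \<subseteq> {x. u \<bullet> x < 1}"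
        by (intro hull_minimal convex_halfspace_lt)
      moreover have "u \<in> convex hull C"
        using u C(3) by (simp add: Z_infty_def hull_inc flip: C(3))
      ultimately show False using norm_supp[OF u] by (auto simp: dot_square_norm)
    qed
  qed
  ultimately have "supp Z = C" by blast
  then show "finite (supp Z)" "card (supp Z) = CARD('n) + 1"
    using C(2) aff_independent_finite[OF C(1)] by auto
qed

text \<open>There is a nonzero \<open>x\<close> orthogonal to the other \<open>n\<close> lifted points. The reproducing formula for \<open>x\<close> then
  only sees \<open>lift u\<close>, so \<open>x\<close> is a multiple of \<open>lift u\<close>.\<close>

lemma card_supp_imp_lift_orthogonal:
  assumes fin: "finite (supp Z)" and card: "card (supp Z) = CARD('n) + 1"
    and u: "u \<in> supp Z" "u' \<in> supp Z" "u \<noteq> u'"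
  shows "lift u \<bullet> lift u' = 0"
proof -
  let ?L = "lift ` (supp Z - {u})"
  have "dim ?L \<le> card ?L" using fin by (intro dim_le_card') auto
  also have "\<dots> \<le> card (supp Z - {u})" using fin by (intro card_image_le) auto
  also have "\<dots> < DIM(real^'n homog)" using fin card u(1) by (simp add: card_homog)
  finally obtain x where x: "x \<noteq> 0" "\<And>y. y \<in> span ?L \<Longrightarrow> orthogonal x y"
    using orthogonal_to_subspace_exists by blast
  have "x = (LINT a|lifted. (x \<bullet> lift a) *\<^sub>R lift a)"
    by (rule lift.reproducing[symmetric])
  also have "\<dots> = (LINT a|lifted. (x \<bullet> lift a) *\<^sub>R lift u)"
  proof (rule integral_cong_AE)
    show "AE a in lifted. (x \<bullet> lift a) *\<^sub>R lift a = (x \<bullet> lift a) *\<^sub>R lift u"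
      using AE_lifted_supp
    proof (rule eventually_mono)
      fix a assume a: "a \<in> supp Z"
      show "(x \<bullet> lift a) *\<^sub>R lift a = (x \<bullet> lift a) *\<^sub>R lift u"
      proof (cases "a = u")
        case False
        then have "orthogonal x (lift a)" using a by (intro x(2) span_base) auto
        then show ?thesis by (simp add: orthogonal_def)
      qed simp
    qed
  qed auto
  also have "\<dots> = (LINT a|lifted. x \<bullet> lift a) *\<^sub>R lift u"
  proof (rule integral_scaleR_left)
    show "integrable lifted (\<lambda>a. x \<bullet> lift a)"
      using lift.inner_v_le by (intro lift.integrable_bounded[where B = "norm x"]) auto
  qed
  finally obtain k where k: "x = k *\<^sub>R lift u" by blast
  have "orthogonal x (lift u')" using u by (intro x(2) span_base) auto
  then show ?thesis using k x(1) by (auto simp: orthogonal_def)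
qed

text \<open>For an orthonormal frame the transport map acts on each coordinate separately by \<open>T\<close>. Its derivative
  is diagonal, which is the equality case of the determinant inequality, and as \<open>T\<close> maps onto the
  positive half line the image misses only the boundary hyperplanes of the cone.\<close>

lemma simplex_imp_eq:
  assumes simplex: "int CARD('n) simplex Z_infty Z" and inscribed: "inscribed_in_sphere (Z_infty Z)"
  shows "measure lebesgue (Z_infty Z) = simplex_volume CARD('n)"
proof -
  note supp = simplex_imp_supp[OF simplex inscribed]
  have inner: "lift u \<bullet> lift u' = (if u = u' then 1 else 0)" if "u \<in> supp Z" "u' \<in> supp Z" for u u'
    using that card_supp_imp_lift_orthogonal[OF supp] inner_lift_eq_1_iff by auto
  let ?F = "\<lambda>x :: real^'n homog. exp (- (height_form \<bullet> x))"
  have "(?F has_integral 1) (range lift.transport)"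
  proof (rule lift.transport_integral_eq_1I[OF height_form_lift])
    fix y :: "real^'n homog"
    let ?t = "\<lambda>a. gauss_exp_deriv (y \<bullet> lift a)"
    show "AE a in lifted. lift.transport_deriv y (lift a) = ?t a *\<^sub>R lift a"
      using AE_lifted_supp
    proof (rule eventually_mono)
      fix a assume a: "a \<in> supp Z"
      have "lift.transport_deriv y (lift a) = (LINT b|lifted. ?t a *\<^sub>R ((lift a \<bullet> lift b) *\<^sub>R lift b))"
        unfolding lift.frame_op_def
      proof (rule integral_cong_AE)
        show "(\<lambda>b. (?t b * (lift a \<bullet> lift b)) *\<^sub>R lift b) \<in> borel_measurable lifted"
          using lift.continuous_inner_v_measurable[OF continuous_on_gauss_exp_deriv, of y] by measurable
        show "AE b in lifted. (?t b * (lift a \<bullet> lift b)) *\<^sub>R lift b = ?t a *\<^sub>R ((lift a \<bullet> lift b) *\<^sub>R lift b)"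
          using AE_lifted_supp by (rule eventually_mono) (auto simp: inner[OF a])
      qed measurable
      also have "\<dots> = ?t a *\<^sub>R lift a"
        by (subst integral_scaleR_right) (simp only: lift.reproducing)
      finally show "lift.transport_deriv y (lift a) = ?t a *\<^sub>R lift a" .
    qed
  qed
  moreover have "(?F has_integral 1) (range lift.transport) \<longleftrightarrow> (?F has_integral 1) cone"
  proof (rule has_integral_spike_set_eq)
    have "{x \<in> range lift.transport - cone. ?F x \<noteq> 0} = {}" using transport_in_cone by blast
    then show "negligible {x \<in> range lift.transport - cone. ?F x \<noteq> 0}" by (simp only: negligible_empty)
    have "cone - range lift.transport \<subseteq> (\<Union>u\<in>supp Z. {x. lift u \<bullet> x = 0})"
    proof (rule ccontr)
      assume "\<not> ?thesis"
      then obtain x where x: "x \<in> cone" "x \<notin> range lift.transport" "\<And>u. u \<in> supp Z \<Longrightarrow> lift u \<bullet> x \<noteq> 0"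
        by blast
      obtain s k where sk: "x = homog (s, (sqrt (real CARD('n)) * s) *\<^sub>R k)" "0 < s" "k \<in> Z_infty Z"
        using x(1) unfolding cone_over_def by blast
      have pos: "0 < lift u \<bullet> x" if u: "u \<in> supp Z" for u
      proof -
        have "supp Z \<subseteq> {k. - 1 / real CARD('n) \<le> u \<bullet> k}"
        proof
          fix u' assume u': "u' \<in> supp Z"
          have "0 \<le> lift u \<bullet> lift u'" using inner[OF u u'] by simp
          then show "u' \<in> {k. - 1 / real CARD('n) \<le> u \<bullet> k}"
            by (simp add: inner_lift zero_le_divide_iff field_simps)
        qed
        then have "Z_infty Z \<subseteq> {k. - 1 / real CARD('n) \<le> u \<bullet> k}"
          unfolding Z_infty_def using convex_halfspace_ge[of "- 1 / real CARD('n)" u]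
          by (intro hull_minimal) auto
        then have "0 \<le> 1 + real CARD('n) * (u \<bullet> k)"
          using sk(3) by (auto simp: field_simps)
        moreover have "lift u \<bullet> x = s / sqrt (real CARD('n) + 1) * (1 + real CARD('n) * (u \<bullet> k))"
          by (simp add: sk(1) lift_def inner_homog real_sqrt_divide algebra_simps)
        ultimately have "0 \<le> lift u \<bullet> x" using sk(2) by simp
        then show ?thesis using x(3)[OF u] by simp
      qed
      have "\<exists>\<tau>. \<forall>u\<in>supp Z. gauss_exp_map (\<tau> u) = lift u \<bullet> x"
      proof (rule bchoice, intro ballI)
        fix u assume "u \<in> supp Z"
        then obtain t where "gauss_exp_map t = lift u \<bullet> x"
          using gauss_exp_map_surj[OF pos] by blast
        then show "\<exists>t. gauss_exp_map t = lift u \<bullet> x" by blast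
      qed
      then obtain \<tau> where \<tau>: "\<And>u. u \<in> supp Z \<Longrightarrow> gauss_exp_map (\<tau> u) = lift u \<bullet> x" by blast
      \<comment> \<open>the preimage of \<open>x\<close>, found coordinate by coordinate in the orthonormal basis of lifts\<close>
      define y where "y = (\<Sum>u\<in>supp Z. \<tau> u *\<^sub>R lift u)"
      have y: "y \<bullet> lift u = \<tau> u" if u: "u \<in> supp Z" for u
      proof -
        have "y \<bullet> lift u = (\<Sum>u'\<in>supp Z. if u' = u then \<tau> u' else 0)"
          unfolding y_def inner_sum_left
          by (rule sum.cong[OF refl]) (use inner[OF _ u] in auto)
        then show ?thesis using supp(1) u by simp
      qed
      have "lift.transport y = (LINT a|lifted. (x \<bullet> lift a) *\<^sub>R lift a)"
        unfolding lift.transport_def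
      proof (rule integral_cong_AE)
        show "(\<lambda>a. gauss_exp_map (y \<bullet> lift a) *\<^sub>R lift a) \<in> borel_measurable lifted"
          using lift.continuous_inner_v_measurable[OF continuous_on_gauss_exp_map, of y] by measurable
        show "AE a in lifted. gauss_exp_map (y \<bullet> lift a) *\<^sub>R lift a = (x \<bullet> lift a) *\<^sub>R lift a"
          using AE_lifted_supp by (rule eventually_mono) (simp add: y \<tau> inner_commute)
      qed measurable
      then have "x = lift.transport y" by (simp add: lift.reproducing)
      then show False using x(2) by blast
    qed
    moreover have "negligible (\<Union>u\<in>supp Z. {x. lift u \<bullet> x = 0})"
    proof (rule negligible_Union[of "(\<lambda>u. {x. lift u \<bullet> x = 0}) ` supp Z"])
      fix T assume "T \<in> (\<lambda>u. {x. lift u \<bullet> x = 0}) ` supp Z"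
      then obtain u where u: "u \<in> supp Z" "T = {x. lift u \<bullet> x = 0}" by blast
      have "lift u \<noteq> 0" using inner[OF u(1) u(1)] by auto
      then show "negligible T" unfolding u(2) by (intro negligible_hyperplane) simp
    qed (use supp(1) in simp)
    ultimately have "negligible (cone - range lift.transport)"
      by (rule negligible_subset[rotated])
    then show "negligible {x \<in> cone - range lift.transport. ?F x \<noteq> 0}"
      by (rule negligible_subset) auto
  qed
  ultimately have "(?F has_integral 1) cone" by simp
  then have "measure lebesgue (Z_infty Z) / simplex_volume CARD('n) = 1"
    using has_integral_cone has_integral_unique by blast
  then show ?thesis by (simp add: divide_eq_1_iff)
qed

end

theorem theorem2:
  fixes Z :: "(real ^ 'n) measure"
  defines "n \<equiv> CARD('n)"
  assumes "finite_sphere_measure Z"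
    and "isotropic Z"
    and "centroid Z = 0"
  shows "measure lebesgue (Z_infty Z)
           \<ge> (real n + 1) powr ((real n + 1) / 2) * real n powr (- (real n / 2)) / fact n
       \<and> (measure lebesgue (Z_infty Z)
             = (real n + 1) powr ((real n + 1) / 2) * real n powr (- (real n / 2)) / fact n
           \<longleftrightarrow> regular_simplex (Z_infty Z) \<and> inscribed_in_sphere (Z_infty Z))"
proof -
  interpret balanced_isotropic Z
    using assms(2-4) by (rule balanced_isotropic.intro)
  have "measure lebesgue (Z_infty Z) = simplex_volume n
      \<longleftrightarrow> regular_simplex (Z_infty Z) \<and> inscribed_in_sphere (Z_infty Z)"
    unfolding n_def using eq_imp_regular_simplex simplex_imp_eq by (auto simp: regular_simplex_def)
  then show ?thesis
    using volume_ge unfolding n_def simplex_volume_def by blast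
qed

end
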